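(* Let $\Gamma$ be a hyperbolic group. Then there exist a measure space $(\Omega,\mu)$ and a closed subspace $E\subset L^1(\Omega,\mu)$ such that $\Gamma$ admits a proper affine uniformly Lipschitz action on $E$.
   Context: A hyperbolic group is a finitely generated group whose Cayley graph with respect to any (equivalently, one) finite generating set is hyperbolic in the sense of Gromov. $L^1(\Omega,\mu)$ is the Banach space of (classes of) real-valued integrable functions, and $E$ carries the induced norm. $\mathcal{B}(E)$ denotes the algebra of bounded linear operators on $E$. An affine action of $\Gamma$ on a Banach space $E$ is given by a representation $\pi:\Gamma\to\mathcal{B}(E)$ (that is, $\pi(e)=\mathrm{id}_E$ and $\pi(st)=\pi(s)\pi(t)$ for all $s,t\in\Gamma$) and a map $b:\Gamma\to E$ satisfying the cocycle identity $b(st)=\pi(s)b(t)+b(s)$ for all $s,t\in\Gamma$; the action is $s\cdot v=\pi(s)v+b(s)$ for $s\in\Gamma$, $v\in E$. The action is uniformly Lipschitz if and only if $\pi$ is uniformly bounded: $\sup_{s\in\Gamma}\|\pi(s)\|<\infty$. A uniformly Lipschitz affine action is proper if and only if $b$ is proper, i.e. for every $R\geq 0$ the set $\{s\in\Gamma : \|b(s)\|_E\leq R\}$ is finite. *)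

theory Defs
  imports "HOL-Analysis.Analysis" "HOL-Algebra.Generated_Groups"
begin

section \<open>Hyperbolic groups\<close>

definition cayley_edges :: "('a, 'b) monoid_scheme \<Rightarrow> 'a set \<Rightarrow> ('a \<times> 'a) set" where
  "cayley_edges G S =
     {(x, y). x \<in> carrier G \<and> y \<in> carrier G \<and>
              (\<exists>s\<in>S. y = x \<otimes>\<^bsub>G\<^esub> s \<or> x = y \<otimes>\<^bsub>G\<^esub> s)}"

text \<open>The path metric of a connected graph given by its symmetric edge relation. The value is
  meaningful only for vertices joined by a path, which is always the case for the Cayley graph of
  a generating set.\<close>

definition graph_dist :: "('v \<times> 'v) set \<Rightarrow> 'v \<Rightarrow> 'v \<Rightarrow> nat" where
  "graph_dist R x y = (LEAST n. (x, y) \<in> R ^^ n)"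

definition gromov_product :: "('v \<Rightarrow> 'v \<Rightarrow> real) \<Rightarrow> 'v \<Rightarrow> 'v \<Rightarrow> 'v \<Rightarrow> real" where
  "gromov_product d w x y = (d x w + d y w - d x y) / 2"

definition gromov_hyperbolic :: "'v set \<Rightarrow> ('v \<Rightarrow> 'v \<Rightarrow> real) \<Rightarrow> bool" where
  "gromov_hyperbolic X d \<longleftrightarrow>
     (\<exists>\<delta>. \<forall>w\<in>X. \<forall>x\<in>X. \<forall>y\<in>X. \<forall>z\<in>X.
        gromov_product d w x z
          \<ge> min (gromov_product d w x y) (gromov_product d w y z) - \<delta>)"

text \<open>Hyperbolicity of the Cayley graph is stated for its vertex set with the path metric; every
  point of the geometric realisation lies within distance 1/2 of a vertex, so passing to the
  realisation only changes the constant.\<close>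

definition hyperbolic_group :: "('a, 'b) monoid_scheme \<Rightarrow> bool" where
  "hyperbolic_group G \<longleftrightarrow>
     group G \<and>
     (\<exists>S. finite S \<and> S \<subseteq> carrier G \<and> generate G S = carrier G \<and>
          gromov_hyperbolic (carrier G) (\<lambda>x y. real (graph_dist (cayley_edges G S) x y)))"


section \<open>The space of classes of integrable functions\<close>

definition L1_rel :: "'x measure \<Rightarrow> (('x \<Rightarrow> real) \<times> ('x \<Rightarrow> real)) set" where
  "L1_rel M = {(f, g). integrable M f \<and> integrable M g \<and> (AE x in M. f x = g x)}"

definition L1_space :: "'x measure \<Rightarrow> ('x \<Rightarrow> real) set set" where
  "L1_space M = {f. integrable M f} // L1_rel M"

definition L1_class :: "'x measure \<Rightarrow> ('x \<Rightarrow> real) \<Rightarrow> ('x \<Rightarrow> real) set" where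
  "L1_class M f = L1_rel M `` {f}"

text \<open>The operations below are defined through a chosen representative of each class; the lemmas
  \<open>L1_add_class\<close>, \<open>L1_scale_class\<close>, \<open>L1_norm_class\<close> show that the choice is irrelevant.\<close>

definition L1_rep :: "('x \<Rightarrow> real) set \<Rightarrow> 'x \<Rightarrow> real" where
  "L1_rep u = (SOME f. f \<in> u)"

definition L1_zero :: "'x measure \<Rightarrow> ('x \<Rightarrow> real) set" where
  "L1_zero M = L1_class M (\<lambda>x. 0)"

definition L1_add :: "'x measure \<Rightarrow> ('x \<Rightarrow> real) set \<Rightarrow> ('x \<Rightarrow> real) set \<Rightarrow> ('x \<Rightarrow> real) set" where
  "L1_add M u v = L1_class M (\<lambda>x. L1_rep u x + L1_rep v x)"

definition L1_scale :: "'x measure \<Rightarrow> real \<Rightarrow> ('x \<Rightarrow> real) set \<Rightarrow> ('x \<Rightarrow> real) set" where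
  "L1_scale M c u = L1_class M (\<lambda>x. c * L1_rep u x)"

definition L1_norm :: "'x measure \<Rightarrow> ('x \<Rightarrow> real) set \<Rightarrow> real" where
  "L1_norm M u = (\<integral>x. \<bar>L1_rep u x\<bar> \<partial>M)"

definition L1_dist :: "'x measure \<Rightarrow> ('x \<Rightarrow> real) set \<Rightarrow> ('x \<Rightarrow> real) set \<Rightarrow> real" where
  "L1_dist M u v = (\<integral>x. \<bar>L1_rep u x - L1_rep v x\<bar> \<partial>M)"

lemma equiv_L1_rel: "equiv {f. integrable M f} (L1_rel M)"
proof (rule equivI)
  show "L1_rel M \<subseteq> {f. integrable M f} \<times> {f. integrable M f}"
    by (auto simp: L1_rel_def)
  show "refl_on {f. integrable M f} (L1_rel M)"
    by (auto simp: L1_rel_def refl_on_def)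
  show "sym (L1_rel M)"
    by (auto simp: L1_rel_def sym_def elim: AE_mp)
  show "trans (L1_rel M)"
    by (rule transI) (auto simp: L1_rel_def elim: AE_mp)
qed

lemma L1_class_in_space: "integrable M f \<Longrightarrow> L1_class M f \<in> L1_space M"
  by (auto simp: L1_class_def L1_space_def intro: quotientI)

lemma L1_class_eqI:
  "integrable M f \<Longrightarrow> integrable M g \<Longrightarrow> AE x in M. f x = g x \<Longrightarrow> L1_class M f = L1_class M g"
  unfolding L1_class_def
  by (rule equiv_class_eq[OF equiv_L1_rel]) (auto simp: L1_rel_def)

lemma L1_rep_class:
  assumes "integrable M f"
  shows "integrable M (L1_rep (L1_class M f))" "AE x in M. L1_rep (L1_class M f) x = f x"
proof -
  have "f \<in> L1_class M f"
    using assms by (auto simp: L1_class_def L1_rel_def)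
  hence "L1_rep (L1_class M f) \<in> L1_class M f"
    unfolding L1_rep_def by (rule someI[where P = "\<lambda>h. h \<in> L1_class M f"])
  thus "integrable M (L1_rep (L1_class M f))" "AE x in M. L1_rep (L1_class M f) x = f x"
    by (auto simp: L1_class_def L1_rel_def elim: AE_mp)
qed

lemma L1_space_cases:
  assumes "u \<in> L1_space M"
  obtains f where "integrable M f" "u = L1_class M f"
  using assms unfolding L1_space_def L1_class_def by (auto elim: quotientE)

lemma L1_add_class:
  assumes "integrable M f" "integrable M g"
  shows "L1_add M (L1_class M f) (L1_class M g) = L1_class M (\<lambda>x. f x + g x)"
  unfolding L1_add_def
  using L1_rep_class[OF assms(1)] L1_rep_class[OF assms(2)] assms
  by (intro L1_class_eqI) auto

lemma L1_scale_class:
  assumes "integrable M f"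
  shows "L1_scale M c (L1_class M f) = L1_class M (\<lambda>x. c * f x)"
  unfolding L1_scale_def
  using L1_rep_class[OF assms] assms by (intro L1_class_eqI) auto

lemma L1_norm_class:
  assumes "integrable M f"
  shows "L1_norm M (L1_class M f) = (\<integral>x. \<bar>f x\<bar> \<partial>M)"
  unfolding L1_norm_def
  using L1_rep_class[OF assms] assms by (intro integral_cong_AE) auto

lemma L1_dist_class:
  assumes "integrable M f" "integrable M g"
  shows "L1_dist M (L1_class M f) (L1_class M g) = (\<integral>x. \<bar>f x - g x\<bar> \<partial>M)"
  unfolding L1_dist_def
  using L1_rep_class[OF assms(1)] L1_rep_class[OF assms(2)] assms
  by (intro integral_cong_AE) auto

lemma L1_dist_eq_norm_diff:
  assumes "u \<in> L1_space M" "v \<in> L1_space M"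
  shows "L1_dist M u v = L1_norm M (L1_add M u (L1_scale M (-1) v))"
proof -
  obtain f where f: "integrable M f" "u = L1_class M f" using assms(1) by (rule L1_space_cases)
  obtain g where g: "integrable M g" "v = L1_class M g" using assms(2) by (rule L1_space_cases)
  show ?thesis
    using f g by (simp add: L1_scale_class L1_add_class L1_norm_class L1_dist_class)
qed

lemma Metric_space_L1: "Metric_space (L1_space M) (L1_dist M)"
proof
  show "0 \<le> L1_dist M u v" for u v
    by (simp add: L1_dist_def)
  show "L1_dist M u v = L1_dist M v u" for u v
    by (simp add: L1_dist_def abs_minus_commute)
  show "L1_dist M u v = 0 \<longleftrightarrow> u = v" if uv: "u \<in> L1_space M" "v \<in> L1_space M" for u v
  proof -
    obtain f where f: "integrable M f" "u = L1_class M f" using uv(1) by (rule L1_space_cases)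
    obtain g where g: "integrable M g" "v = L1_class M g" using uv(2) by (rule L1_space_cases)
    have int: "integrable M (\<lambda>x. \<bar>f x - g x\<bar>)"
      using f g by auto
    show ?thesis
    proof
      assume "L1_dist M u v = 0"
      hence "AE x in M. \<bar>f x - g x\<bar> = 0"
        using f g integral_nonneg_eq_0_iff_AE[OF int] by (simp add: L1_dist_class)
      hence "AE x in M. f x = g x" by simp
      thus "u = v" using f g L1_class_eqI by blast
    next
      assume "u = v"
      thus "L1_dist M u v = 0" by (simp add: L1_dist_def)
    qed
  qed
  show "L1_dist M u w \<le> L1_dist M u v + L1_dist M v w"
    if uvw: "u \<in> L1_space M" "v \<in> L1_space M" "w \<in> L1_space M" for u v w
  proof -
    obtain f where f: "integrable M f" "u = L1_class M f" using uvw(1) by (rule L1_space_cases)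
    obtain g where g: "integrable M g" "v = L1_class M g" using uvw(2) by (rule L1_space_cases)
    obtain h where h: "integrable M h" "w = L1_class M h" using uvw(3) by (rule L1_space_cases)
    have "(\<integral>x. \<bar>f x - h x\<bar> \<partial>M) \<le> (\<integral>x. \<bar>f x - g x\<bar> + \<bar>g x - h x\<bar> \<partial>M)"
      using f g h by (intro integral_mono) auto
    also have "\<dots> = (\<integral>x. \<bar>f x - g x\<bar> \<partial>M) + (\<integral>x. \<bar>g x - h x\<bar> \<partial>M)"
      using f g h by (intro Bochner_Integration.integral_add) auto
    finally show ?thesis using f g h by (simp add: L1_dist_class)
  qed
qed

definition L1_closed_subspace :: "'x measure \<Rightarrow> ('x \<Rightarrow> real) set set \<Rightarrow> bool" where
  "L1_closed_subspace M E \<longleftrightarrow>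
     E \<subseteq> L1_space M \<and> L1_zero M \<in> E \<and>
     (\<forall>u\<in>E. \<forall>v\<in>E. L1_add M u v \<in> E) \<and>
     (\<forall>c. \<forall>u\<in>E. L1_scale M c u \<in> E) \<and>
     closedin (Metric_space.mtopology (L1_space M) (L1_dist M)) E"


section \<open>Affine actions\<close>

text \<open>HOL cannot quantify existentially over the type of points of a measure space. For the
  existence of a proper affine action of a finitely generated, hence countable, group on a closed
  subspace of some \<open>L\<^sup>1\<close> space, measures on subsets of the reals are as general as arbitrary ones:
  the closed linear span of the values of the cocycle is invariant and separable, and a separable
  subspace of an \<open>L\<^sup>1\<close> space embeds linearly and isometrically into \<open>L\<^sup>1([0,1])\<close>.\<close>

text \<open>Operators and cocycles are total functions of which only the values on \<open>E\<close>, respectively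
  on the carrier of the group, are relevant.\<close>

definition bounded_operator ::
    "'x measure \<Rightarrow> ('x \<Rightarrow> real) set set \<Rightarrow> (('x \<Rightarrow> real) set \<Rightarrow> ('x \<Rightarrow> real) set) \<Rightarrow> bool" where
  "bounded_operator M E T \<longleftrightarrow>
     T \<in> E \<rightarrow> E \<and>
     (\<forall>u\<in>E. \<forall>v\<in>E. T (L1_add M u v) = L1_add M (T u) (T v)) \<and>
     (\<forall>c. \<forall>u\<in>E. T (L1_scale M c u) = L1_scale M c (T u)) \<and>
     (\<exists>K. \<forall>u\<in>E. L1_norm M (T u) \<le> K * L1_norm M u)"

definition operator_norm ::
    "'x measure \<Rightarrow> ('x \<Rightarrow> real) set set \<Rightarrow> (('x \<Rightarrow> real) set \<Rightarrow> ('x \<Rightarrow> real) set) \<Rightarrow> real" where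
  "operator_norm M E T = (SUP u\<in>{u \<in> E. L1_norm M u \<le> 1}. L1_norm M (T u))"

definition affine_action ::
    "('a, 'b) monoid_scheme \<Rightarrow> 'x measure \<Rightarrow> ('x \<Rightarrow> real) set set \<Rightarrow>
     ('a \<Rightarrow> ('x \<Rightarrow> real) set \<Rightarrow> ('x \<Rightarrow> real) set) \<Rightarrow> ('a \<Rightarrow> ('x \<Rightarrow> real) set) \<Rightarrow> bool" where
  "affine_action G M E \<pi> b \<longleftrightarrow>
     (\<forall>s\<in>carrier G. bounded_operator M E (\<pi> s)) \<and>
     (\<forall>u\<in>E. \<pi> \<one>\<^bsub>G\<^esub> u = u) \<and>
     (\<forall>s\<in>carrier G. \<forall>t\<in>carrier G. \<forall>u\<in>E. \<pi> (s \<otimes>\<^bsub>G\<^esub> t) u = \<pi> s (\<pi> t u)) \<and>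
     b \<in> carrier G \<rightarrow> E \<and>
     (\<forall>s\<in>carrier G. \<forall>t\<in>carrier G. b (s \<otimes>\<^bsub>G\<^esub> t) = L1_add M (\<pi> s (b t)) (b s))"

text \<open>The next two notions are those for the affine action \<open>s \<cdot> v = \<pi> s v + b s\<close>: the best Lipschitz
  constant of \<open>v \<mapsto> s \<cdot> v\<close> is the operator norm of \<open>\<pi> s\<close>, and a uniformly Lipschitz action is proper
  iff its cocycle \<open>b\<close> is.\<close>

definition uniformly_Lipschitz ::
    "('a, 'b) monoid_scheme \<Rightarrow> 'x measure \<Rightarrow> ('x \<Rightarrow> real) set set \<Rightarrow>
     ('a \<Rightarrow> ('x \<Rightarrow> real) set \<Rightarrow> ('x \<Rightarrow> real) set) \<Rightarrow> bool" where
  "uniformly_Lipschitz G M E \<pi> \<longleftrightarrow> bdd_above ((\<lambda>s. operator_norm M E (\<pi> s)) ` carrier G)"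

definition proper_cocycle ::
    "('a, 'b) monoid_scheme \<Rightarrow> 'x measure \<Rightarrow> ('a \<Rightarrow> ('x \<Rightarrow> real) set) \<Rightarrow> bool" where
  "proper_cocycle G M b \<longleftrightarrow> (\<forall>R\<ge>0. finite {s \<in> carrier G. L1_norm M (b s) \<le> R})"

end

theory Submission
  imports Defs
begin

text \<open>
  It suffices to find a norm on the finitely supported functions of sum zero on \<open>\<Gamma>\<close> which comes
  from a linear map into an \<open>\<ell>\<^sup>1\<close> space, for which the translations are uniformly bounded, and for
  which \<open>\<parallel>\<delta>\<^sub>s - \<delta>\<^sub>e\<parallel>\<close> tends to infinity with \<open>s\<close>: then \<open>b(s) = \<delta>\<^sub>s - \<delta>\<^sub>e\<close> is a proper cocycle for the
  translation action. For a free group one takes the norm of the flow on the edges of the tree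
  with divergence \<open>f\<close>. For a hyperbolic group the flow is replaced by an approximate one. Suppose
  that there are functions \<open>q(a,x)\<close> in \<open>\<ell>\<^sup>1(\<Gamma> \<times> \<Gamma>)\<close>, to be thought of as a flow from \<open>x\<close> to \<open>a\<close>,
  equivariant under \<open>\<Gamma>\<close>, with \<open>\<parallel>q(e,x)\<parallel> \<rightarrow> \<infinity>\<close> and with
    \<open>\<parallel>q(s,x) - q(s,y) - q(t,x) + q(t,y)\<parallel> \<le> C\<close> for all \<open>s, t, x, y\<close>.
  Put \<open>\<Phi>(f) = \<Sum>\<^sub>x f(x) q(e,x)\<close> and use the norm \<open>\<parallel>f\<parallel>\<^sub>1 + \<parallel>\<Phi>(f)\<parallel>\<^sub>1\<close>. Translating \<open>f\<close> by \<open>s\<close> amounts to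
  moving the base point \<open>e\<close> of \<open>\<Phi>\<close> to \<open>s\<^sup>-\<^sup>1\<close>, and because \<open>f\<close> has sum zero, the bound on the mixed
  differences shows that this changes \<open>\<Phi>(f)\<close> by at most \<open>C \<parallel>f\<parallel>\<^sub>1\<close>. Therefore each translation has norm
  at most \<open>1 + C\<close> (\<open>potential_translate\<close>, \<open>finite_energy_translate\<close>).

  The flow is obtained from visual metrics. For a point \<open>z\<close> the kernel \<open>2\<^bsup>-(x|y)\<^sub>z/2\<delta>\<^esup>\<close>
  satisfies the ultrametric inequality up to the factor \<open>\<surd>2\<close>, so that by the
  metrization argument of Frink (\<open>chain_quasi_ultrametric\<close>) the infimum \<open>\<rho>\<^sub>z\<close> of its sums along chains is
  comparable to it. Let \<open>q(a,x)(z,w)\<close> be \<open>\<rho>\<^sub>z(w,a) - \<rho>\<^sub>z(w,x)\<close>, for the finitely many \<open>w\<close> in a fixed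
  ball about \<open>z\<close>, after a soft threshold which replaces small values by zero. Without the threshold
  all mixed differences would vanish, but the family would not be summable in \<open>z\<close>; the threshold
  confines \<open>q(a,x)\<close> to a neighbourhood of the geodesics from \<open>a\<close> to \<open>x\<close>. At a point \<open>z\<close> next to a
  geodesic from \<open>s\<close> to \<open>x\<close>, each of \<open>t\<close> and \<open>y\<close> lies, as seen from \<open>z\<close>, on the side of \<open>s\<close> or on
  the side of \<open>x\<close>. Whatever the combination, the mixed difference at \<open>z\<close> is bounded by kernels that
  decay exponentially in the distance from \<open>z\<close> to the places where \<open>t\<close> and \<open>y\<close> branch off
  (\<open>mixed_difference_near_geodesic\<close>); oddness of the threshold is what settles the case in which \<open>s\<close>
  and \<open>y\<close> are on one side and \<open>x\<close> and \<open>t\<close> on the other. As the number of \<open>z\<close> at a given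
  distance from \<open>s\<close> is bounded, geometric series give the constant \<open>C\<close> (\<open>mixed_difference_bounded\<close>).
  Finally \<open>\<parallel>q(a,x)\<parallel>\<close> grows with the distance from \<open>a\<close> to \<open>x\<close>, since every point of a geodesic far from
  \<open>x\<close> contributes a definite amount (\<open>flow_lower\<close>).
\<close>

section \<open>Chains for a kernel that is almost an ultrametric\<close>

text \<open>Split the chain at the last point before which at most half of the total sum has been
  spent: the part before that point, the link leaving it and the part after that link each have, by
  induction, kernel at most the total sum. Joining the three pieces costs \<open>\<kappa>\<^sup>2 \<le> 2\<close>.\<close>

lemma chain_quasi_ultrametric:
  fixes K :: "'v \<Rightarrow> 'v \<Rightarrow> real"
  assumes nonneg: "\<And>a b. 0 \<le> K a b"
    and quasi: "\<And>a b c. a \<in> X \<Longrightarrow> b \<in> X \<Longrightarrow> c \<in> X \<Longrightarrow> K a c \<le> \<kappa> * max (K a b) (K b c)"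
    and \<kappa>: "1 \<le> \<kappa>" "\<kappa> * \<kappa> \<le> 2"
    and p: "\<And>i. p i \<in> X" and "m < n"
  shows "K (p m) (p n) \<le> 2 * (\<Sum>i=m..<n. K (p i) (p (Suc i)))"
  using \<open>m < n\<close>
proof (induction "n - m" arbitrary: m n rule: less_induct)
  case less
  \<comment> \<open>\<open>S k l\<close> is the part of the sum between the \<open>k\<close>-th and the \<open>l\<close>-th point\<close>
  define S where "S k l = (\<Sum>i=k..<l. K (p i) (p (Suc i)))" for k l
  have S_nonneg: "0 \<le> S k l" for k l
    unfolding S_def by (intro sum_nonneg nonneg)
  have S_split: "S k j + S j l = S k l" if "k \<le> j" "j \<le> l" for k j l
    unfolding S_def using that by (rule sum.atLeastLessThan_concat)
  have S_link: "K (p k) (p (Suc k)) = S k (Suc k)" for k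
    by (simp add: S_def)
  define k where "k = (GREATEST k. m \<le> k \<and> k < n \<and> S m k \<le> S m n / 2)"
  have k: "m \<le> k \<and> k < n \<and> S m k \<le> S m n / 2"
    unfolding k_def
    by (rule GreatestI_nat[where k = m and b = n])
       (use less.prems S_nonneg[of m n] in \<open>auto simp: S_def\<close>)
  have tail: "S (Suc k) n \<le> S m n / 2"
  proof (cases "Suc k < n")
    case True
    have "\<not> S m (Suc k) \<le> S m n / 2"
    proof
      assume "S m (Suc k) \<le> S m n / 2"
      hence "Suc k \<le> k"
        unfolding k_def
        by (intro Greatest_le_nat[where b = n]) (use True k k_def in auto)
      thus False by simp
    qed
    thus ?thesis
      using S_split[of m "Suc k" n] k True by simp
  next
    case False
    thus ?thesis using S_nonneg[of m n] by (simp add: S_def)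
  qed
  have step: "K (p k) (p (Suc k)) \<le> S m n"
    using S_link[of k] S_split[of m k "Suc k"] S_split[of m "Suc k" n] S_nonneg[of m k]
      S_nonneg[of "Suc k" n] k by simp
  have head: "K (p m) (p (Suc k)) \<le> \<kappa> * S m n"
  proof (cases "m = k")
    case True
    thus ?thesis using step mult_right_mono[OF \<kappa>(1) S_nonneg[of m n]] by simp
  next
    case False
    have "K (p m) (p k) \<le> 2 * S m k"
      unfolding S_def using less.hyps[of k m] k False by auto
    hence "max (K (p m) (p k)) (K (p k) (p (Suc k))) \<le> S m n"
      using k step by simp
    thus ?thesis
      using quasi[OF p[of m] p[of k] p[of "Suc k"]] \<kappa>(1) by (smt (verit) mult_left_mono)
  qed
  have "K (p m) (p n) \<le> 2 * S m n"
  proof (cases "Suc k = n")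
    case True
    have "\<kappa> * 1 \<le> \<kappa> * \<kappa>" using \<kappa>(1) by (intro mult_left_mono) auto
    hence "\<kappa> \<le> 2" using \<kappa>(2) by simp
    hence "\<kappa> * S m n \<le> 2 * S m n" by (intro mult_right_mono S_nonneg)
    thus ?thesis using head True by simp
  next
    case False
    have "K (p (Suc k)) (p n) \<le> 2 * S (Suc k) n"
      unfolding S_def using less.hyps[of n "Suc k"] k False by auto
    hence "K (p (Suc k)) (p n) \<le> S m n" using tail by simp
    also have "\<dots> \<le> \<kappa> * S m n"
      using mult_right_mono[OF \<kappa>(1) S_nonneg[of m n]] by simp
    finally have "max (K (p m) (p (Suc k))) (K (p (Suc k)) (p n)) \<le> \<kappa> * S m n"
      using head by simp
    hence "K (p m) (p n) \<le> \<kappa> * (\<kappa> * S m n)"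
      using quasi[OF p[of m] p[of "Suc k"] p[of n]] \<kappa>(1) by (smt (verit) mult_left_mono)
    also have "\<dots> \<le> 2 * S m n"
      using mult_right_mono[OF \<kappa>(2) S_nonneg[of m n]] by (simp add: mult.assoc)
    finally show ?thesis .
  qed
  thus ?case by (simp add: S_def)
qed

section \<open>Mixed differences of a thresholded difference\<close>

text \<open>The odd \<open>1\<close>-Lipschitz function that moves every real number towards zero by \<open>\<eta>\<close>,
  but not beyond zero.\<close>

definition soft_threshold :: "real \<Rightarrow> real \<Rightarrow> real" where
  "soft_threshold \<eta> r = max 0 (r - \<eta>) - max 0 (- r - \<eta>)"

lemma soft_threshold_minus: "soft_threshold \<eta> (- r) = - soft_threshold \<eta> r"
  by (simp add: soft_threshold_def)

lemma soft_threshold_Lipschitz: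
  "0 \<le> \<eta> \<Longrightarrow> \<bar>soft_threshold \<eta> r - soft_threshold \<eta> r'\<bar> \<le> \<bar>r - r'\<bar>"
  unfolding soft_threshold_def by (smt (verit))

lemma soft_threshold_eq_0: "0 \<le> \<eta> \<Longrightarrow> \<bar>r\<bar> \<le> \<eta> \<Longrightarrow> soft_threshold \<eta> r = 0"
  by (auto simp: soft_threshold_def)

lemma abs_soft_threshold:
  assumes "0 \<le> \<eta>"
  shows "\<bar>soft_threshold \<eta> r\<bar> = max 0 (\<bar>r\<bar> - \<eta>)"
  using assms by (auto simp: soft_threshold_def max_def)

text \<open>For the identity in place of the threshold the mixed difference is zero. The first two bounds
  express that it is controlled by the variation in either pair of variables. For the third,
  if \<open>s\<close> is close to \<open>x\<close> and \<open>t\<close> to \<open>y\<close>, then \<open>s - y\<close> is close to \<open>-(t - x)\<close>, and the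
  corresponding values cancel because the threshold is odd.\<close>

lemma soft_threshold_mixed_difference:
  fixes s t x y \<eta> :: real
  assumes "0 \<le> \<eta>"
  defines "D \<equiv> soft_threshold \<eta> (s - x) - soft_threshold \<eta> (s - y)
                - soft_threshold \<eta> (t - x) + soft_threshold \<eta> (t - y)"
  shows "\<bar>D\<bar> \<le> 2 * \<bar>s - t\<bar>" "\<bar>D\<bar> \<le> 2 * \<bar>x - y\<bar>" "\<bar>D\<bar> \<le> 2 * (\<bar>s - x\<bar> + \<bar>t - y\<bar>)"
proof -
  note L = soft_threshold_Lipschitz[OF assms(1)]
  have "\<bar>soft_threshold \<eta> (s - x) - soft_threshold \<eta> (t - x)\<bar> \<le> \<bar>s - t\<bar>"
    using L[of "s - x" "t - x"] by simp
  moreover have "\<bar>soft_threshold \<eta> (s - y) - soft_threshold \<eta> (t - y)\<bar> \<le> \<bar>s - t\<bar>"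
    using L[of "s - y" "t - y"] by simp
  ultimately show "\<bar>D\<bar> \<le> 2 * \<bar>s - t\<bar>" unfolding D_def by (smt (verit))
  have "\<bar>soft_threshold \<eta> (s - x) - soft_threshold \<eta> (s - y)\<bar> \<le> \<bar>x - y\<bar>"
    using L[of "s - x" "s - y"] by simp
  moreover have "\<bar>soft_threshold \<eta> (t - x) - soft_threshold \<eta> (t - y)\<bar> \<le> \<bar>x - y\<bar>"
    using L[of "t - x" "t - y"] by simp
  ultimately show "\<bar>D\<bar> \<le> 2 * \<bar>x - y\<bar>" unfolding D_def by (smt (verit))
  have "\<bar>soft_threshold \<eta> (s - x)\<bar> \<le> \<bar>s - x\<bar>" "\<bar>soft_threshold \<eta> (t - y)\<bar> \<le> \<bar>t - y\<bar>"
    using assms by (auto simp: abs_soft_threshold)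
  moreover have "\<bar>soft_threshold \<eta> (s - y) + soft_threshold \<eta> (t - x)\<bar> \<le> \<bar>s - x\<bar> + \<bar>t - y\<bar>"
    using L[of "s - y" "- (t - x)"] unfolding soft_threshold_minus by (smt (verit))
  ultimately show "\<bar>D\<bar> \<le> 2 * (\<bar>s - x\<bar> + \<bar>t - y\<bar>)" unfolding D_def by (smt (verit))
qed

lemma sum_geometric_le:
  fixes \<rho> :: real
  assumes "0 \<le> \<rho>" "\<rho> < 1" "finite I"
  shows "(\<Sum>i\<in>I. \<rho> ^ i) \<le> 1 / (1 - \<rho>)"
proof -
  have "(\<Sum>i\<in>I. \<rho> ^ i) \<le> (\<Sum>i. \<rho> ^ i)"
    using assms by (intro sum_le_suminf summable_geometric) auto
  thus ?thesis using assms by (simp add: suminf_geometric)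
qed

text \<open>On either side of \<open>m\<close> distinct integers have distinct values of \<open>\<lfloor>\<bar>i - m\<bar>\<rfloor>\<close>, so that the
  sum is bounded by two geometric series, uniformly in the centre \<open>m\<close>.\<close>

lemma sum_two_sided_geometric_le:
  fixes m a :: real and I :: "nat set"
  assumes "0 < a" "finite I"
  shows "(\<Sum>i\<in>I. 2 powr (- a * \<bar>real i - m\<bar>)) \<le> 2 / (1 - 2 powr (- a))"
proof -
  define \<rho> where "\<rho> = 2 powr (- a)"
  have \<rho>: "0 < \<rho>" "\<rho> < 1"
    using assms powr_less_mono[of "-a" 0 2] by (auto simp: \<rho>_def)
  \<comment> \<open>\<open>2 powr (- a * \<bar>real i - m\<bar>)\<close> is at most the \<open>h i\<close>-th power of the ratio \<open>\<rho>\<close>\<close>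
  define h where "h i = nat \<lfloor>\<bar>real i - m\<bar>\<rfloor>" for i :: nat
  have le: "2 powr (- a * \<bar>real i - m\<bar>) \<le> \<rho> ^ h i" for i
  proof -
    have "\<rho> ^ h i = 2 powr (- a * real (h i))"
      using \<rho>(1) by (simp add: \<rho>_def powr_powr flip: powr_realpow)
    moreover have "real (h i) \<le> \<bar>real i - m\<bar>"
      unfolding h_def by linarith
    ultimately show ?thesis using assms(1) by (simp add: mult_left_mono)
  qed
  have half: "(\<Sum>i\<in>J. 2 powr (- a * \<bar>real i - m\<bar>)) \<le> 1 / (1 - \<rho>)"
    if J: "finite J" "inj_on h J" for J
  proof -
    have "(\<Sum>i\<in>J. 2 powr (- a * \<bar>real i - m\<bar>)) \<le> (\<Sum>i\<in>J. \<rho> ^ h i)"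
      by (intro sum_mono le)
    also have "\<dots> = (\<Sum>j\<in>h ` J. \<rho> ^ j)"
      using J(2) by (simp add: sum.reindex)
    also have "\<dots> \<le> 1 / (1 - \<rho>)"
      using \<rho> J by (intro sum_geometric_le) auto
    finally show ?thesis .
  qed
  have inj1: "inj_on h {i \<in> I. real i \<le> m}"
  proof (rule inj_onI)
    fix i j assume "i \<in> {i \<in> I. real i \<le> m}" "j \<in> {i \<in> I. real i \<le> m}" "h i = h j"
    hence "\<lfloor>m - real i\<rfloor> = \<lfloor>m - real j\<rfloor>" by (auto simp: h_def eq_nat_nat_iff)
    thus "i = j" by linarith
  qed
  have inj2: "inj_on h {i \<in> I. \<not> real i \<le> m}"
  proof (rule inj_onI)
    fix i j assume "i \<in> {i \<in> I. \<not> real i \<le> m}" "j \<in> {i \<in> I. \<not> real i \<le> m}" "h i = h j"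
    hence "\<lfloor>real i - m\<rfloor> = \<lfloor>real j - m\<rfloor>" by (auto simp: h_def eq_nat_nat_iff)
    thus "i = j" by linarith
  qed
  have I_split: "I = {i \<in> I. real i \<le> m} \<union> {i \<in> I. \<not> real i \<le> m}" by auto
  have "(\<Sum>i\<in>I. 2 powr (- a * \<bar>real i - m\<bar>))
        = (\<Sum>i\<in>{i \<in> I. real i \<le> m}. 2 powr (- a * \<bar>real i - m\<bar>))
        + (\<Sum>i\<in>{i \<in> I. \<not> real i \<le> m}. 2 powr (- a * \<bar>real i - m\<bar>))"
    by (subst I_split, rule sum.union_disjoint) (use assms(2) in auto)
  also have "\<dots> \<le> 1 / (1 - \<rho>) + 1 / (1 - \<rho>)"
    using assms(2) inj1 inj2 by (intro add_mono half) auto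
  finally show ?thesis by (simp add: \<rho>_def)
qed

section \<open>Visual metrics of a hyperbolic graph\<close>

text \<open>The properties of the word metric of a hyperbolic group that the construction of the flow rests on.
  The balls are bounded uniformly in the centre by \<open>N\<close>, which makes the number of points in
  play near a geodesic depend only on \<open>\<delta>\<close>.\<close>

locale hyperbolic_graph_metric =
  fixes X :: "'v set" and d :: "'v \<Rightarrow> 'v \<Rightarrow> nat" and \<delta> :: real and N :: "nat \<Rightarrow> nat"
  assumes d_sym: "x \<in> X \<Longrightarrow> y \<in> X \<Longrightarrow> d x y = d y x"
    and d_triangle: "x \<in> X \<Longrightarrow> y \<in> X \<Longrightarrow> z \<in> X \<Longrightarrow> d x z \<le> d x y + d y z"
    and geodesic: "x \<in> X \<Longrightarrow> y \<in> X \<Longrightarrow> i \<le> d x y \<Longrightarrow> \<exists>z\<in>X. d x z = i \<and> d z y = d x y - i"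
    and finite_ball: "x \<in> X \<Longrightarrow> finite {y \<in> X. d x y \<le> r}"
    and card_ball: "x \<in> X \<Longrightarrow> card {y \<in> X. d x y \<le> r} \<le> N r"
    and delta_pos: "0 < \<delta>"
    and hyperbolic: "w \<in> X \<Longrightarrow> x \<in> X \<Longrightarrow> y \<in> X \<Longrightarrow> z \<in> X \<Longrightarrow>
          gromov_product (\<lambda>x y. real (d x y)) w x z
          \<ge> min (gromov_product (\<lambda>x y. real (d x y)) w x y)
                (gromov_product (\<lambda>x y. real (d x y)) w y z) - \<delta>"
begin

abbreviation gp :: "'v \<Rightarrow> 'v \<Rightarrow> 'v \<Rightarrow> real" where
  "gp z x y \<equiv> gromov_product (\<lambda>x y. real (d x y)) z x y"

lemma gp_commute: "x \<in> X \<Longrightarrow> y \<in> X \<Longrightarrow> gp z x y = gp z y x"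
  by (simp add: gromov_product_def d_sym add.commute)

lemma gp_nonneg: "x \<in> X \<Longrightarrow> y \<in> X \<Longrightarrow> z \<in> X \<Longrightarrow> 0 \<le> gp z x y"
  using d_triangle[of x z y] d_sym[of y z] by (simp add: gromov_product_def)

text \<open>The rate \<open>1/(2\<delta>)\<close> turns the error \<open>\<delta>\<close> of the hyperbolic inequality into the factor \<open>\<surd>2\<close>,
  the largest one for which \<open>chain_quasi_ultrametric\<close> applies.\<close>

definition kernel :: "'v \<Rightarrow> 'v \<Rightarrow> 'v \<Rightarrow> real" where
  "kernel z x y = 2 powr (- gp z x y / (2 * \<delta>))"

lemma kernel_pos: "0 < kernel z x y"
  by (simp add: kernel_def)

lemma kernel_le_1: "x \<in> X \<Longrightarrow> y \<in> X \<Longrightarrow> z \<in> X \<Longrightarrow> kernel z x y \<le> 1"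
  using gp_nonneg[of x y z] delta_pos powr_mono[of "- gp z x y / (2 * \<delta>)" 0 2]
  by (simp add: kernel_def)

lemma kernel_commute: "x \<in> X \<Longrightarrow> y \<in> X \<Longrightarrow> kernel z x y = kernel z y x"
  by (simp add: kernel_def gp_commute)

lemma kernel_le_iff: "kernel z x y \<le> 2 powr (- r / (2 * \<delta>)) \<longleftrightarrow> r \<le> gp z x y"
  using delta_pos by (simp add: kernel_def divide_le_cancel)

lemma kernel_ge_iff: "2 powr (- r / (2 * \<delta>)) \<le> kernel z x y \<longleftrightarrow> gp z x y \<le> r"
  using delta_pos by (simp add: kernel_def divide_le_cancel)

lemma kernel_quasi_ultrametric:
  assumes "z \<in> X" "a \<in> X" "b \<in> X" "c \<in> X"
  shows "kernel z a c \<le> sqrt 2 * max (kernel z a b) (kernel z b c)"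
proof -
  have "- gp z a c / (2 * \<delta>) \<le> 1 / 2 + - min (gp z a b) (gp z b c) / (2 * \<delta>)"
    using hyperbolic[of z a b c] assms delta_pos by (simp add: field_simps)
  hence "kernel z a c \<le> 2 powr (1 / 2 + - min (gp z a b) (gp z b c) / (2 * \<delta>))"
    unfolding kernel_def by (intro powr_mono) auto
  also have "\<dots> = sqrt 2 * 2 powr (- min (gp z a b) (gp z b c) / (2 * \<delta>))"
    by (simp only: powr_add powr_half_sqrt[of 2, simplified])
  also have "2 powr (- min (gp z a b) (gp z b c) / (2 * \<delta>)) \<le> max (kernel z a b) (kernel z b c)"
    by (auto simp: kernel_def min_def max_def)
  finally show ?thesis by (simp add: mult_left_mono)
qed

text \<open>A chain has at least one link. Hence \<open>kernel z w a / 2\<close> bounds the sums from below also for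
  \<open>a = w\<close>, where the kernel is positive.\<close>

definition chain_sums :: "'v \<Rightarrow> 'v \<Rightarrow> 'v \<Rightarrow> real set" where
  "chain_sums z w a =
     {\<Sum>i<Suc n. kernel z (p i) (p (Suc i)) |p n. (\<forall>i. p i \<in> X) \<and> p 0 = w \<and> p (Suc n) = a}"

definition visual :: "'v \<Rightarrow> 'v \<Rightarrow> 'v \<Rightarrow> real" where
  "visual z w a = Inf (chain_sums z w a)"

lemma kernel_in_chain_sums:
  assumes "w \<in> X" "a \<in> X"
  shows "kernel z w a \<in> chain_sums z w a"
  unfolding chain_sums_def
  by (rule CollectI, rule exI[of _ "\<lambda>i. if i = 0 then w else a"], rule exI[of _ 0])
     (use assms in auto)

lemma chain_sums_lower:
  assumes "z \<in> X" "r \<in> chain_sums z w a"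
  shows "kernel z w a / 2 \<le> r"
proof -
  obtain p n where p: "\<forall>i. p i \<in> X" "p 0 = w" "p (Suc n) = a"
    and r: "r = (\<Sum>i<Suc n. kernel z (p i) (p (Suc i)))"
    using assms(2) unfolding chain_sums_def by blast
  have "kernel z (p 0) (p (Suc n)) \<le> 2 * (\<Sum>i=0..<Suc n. kernel z (p i) (p (Suc i)))"
    using p assms(1)
    by (intro chain_quasi_ultrametric[where X = X and \<kappa> = "sqrt 2"])
       (auto intro: kernel_quasi_ultrametric less_imp_le[OF kernel_pos])
  thus ?thesis
    unfolding r lessThan_atLeast0 p(2,3) by simp
qed

lemma bdd_below_chain_sums: "z \<in> X \<Longrightarrow> bdd_below (chain_sums z w a)"
  by (rule bdd_belowI[of _ "kernel z w a / 2"]) (rule chain_sums_lower)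

lemma visual_ge: "z \<in> X \<Longrightarrow> w \<in> X \<Longrightarrow> a \<in> X \<Longrightarrow> kernel z w a / 2 \<le> visual z w a"
  unfolding visual_def
  using kernel_in_chain_sums by (intro cInf_greatest chain_sums_lower) auto

lemma visual_le: "z \<in> X \<Longrightarrow> w \<in> X \<Longrightarrow> a \<in> X \<Longrightarrow> visual z w a \<le> kernel z w a"
  unfolding visual_def by (intro cInf_lower kernel_in_chain_sums bdd_below_chain_sums)

lemma chain_sums_append:
  assumes "r \<in> chain_sums z w a" "b \<in> X"
  shows "r + kernel z a b \<in> chain_sums z w b"
proof -
  obtain p n where p: "\<forall>i. p i \<in> X" "p 0 = w" "p (Suc n) = a"
    and r: "r = (\<Sum>i<Suc n. kernel z (p i) (p (Suc i)))"
    using assms(1) unfolding chain_sums_def by blast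
  define p' where "p' i = (if i \<le> Suc n then p i else b)" for i
  have "(\<Sum>i<Suc (Suc n). kernel z (p' i) (p' (Suc i))) = r + kernel z a b"
    by (simp add: r p'_def p)
  moreover have "\<forall>i. p' i \<in> X" "p' 0 = w" "p' (Suc (Suc n)) = b"
    using p assms(2) by (auto simp: p'_def)
  ultimately show ?thesis
    unfolding chain_sums_def by (intro CollectI exI[of _ p'] exI[of _ "Suc n"]) auto
qed

text \<open>A chain from \<open>w\<close> to \<open>a\<close> followed by the link to \<open>b\<close> is a chain from \<open>w\<close> to \<open>b\<close>.\<close>

lemma visual_diff_le:
  assumes "z \<in> X" "w \<in> X" "a \<in> X" "b \<in> X"
  shows "\<bar>visual z w a - visual z w b\<bar> \<le> kernel z a b"
proof -
  have "visual z w b - kernel z a b \<le> visual z w a" if "a \<in> X" "b \<in> X" for a b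
    unfolding visual_def[of z w a]
  proof (rule cInf_greatest)
    show "chain_sums z w a \<noteq> {}" using kernel_in_chain_sums[of w a] assms that by auto
    fix r assume "r \<in> chain_sums z w a"
    hence "r + kernel z a b \<in> chain_sums z w b" using that by (intro chain_sums_append)
    hence "visual z w b \<le> r + kernel z a b"
      unfolding visual_def using assms by (intro cInf_lower bdd_below_chain_sums)
    thus "visual z w b - kernel z a b \<le> r" by simp
  qed
  from this[of a b] this[of b a] show ?thesis
    using assms kernel_commute[of a b] by auto
qed

lemma visual_isometry:
  assumes "bij_betw f X X" and iso: "\<And>x y. x \<in> X \<Longrightarrow> y \<in> X \<Longrightarrow> d (f x) (f y) = d x y"
    and "z \<in> X" "w \<in> X" "a \<in> X"
  shows "visual (f z) (f w) (f a) = visual z w a"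
proof -
  have sub: "chain_sums z w a \<subseteq> chain_sums (g z) (g w) (g a)"
    if g: "\<And>x. x \<in> X \<Longrightarrow> g x \<in> X" "\<And>x y. x \<in> X \<Longrightarrow> y \<in> X \<Longrightarrow> d (g x) (g y) = d x y"
      and "z \<in> X" for g z w a
  proof
    fix r assume "r \<in> chain_sums z w a"
    then obtain p n where p: "\<forall>i. p i \<in> X" "p 0 = w" "p (Suc n) = a"
      and r: "r = (\<Sum>i<Suc n. kernel z (p i) (p (Suc i)))"
      unfolding chain_sums_def by blast
    have "kernel (g z) (g (p i)) (g (p (Suc i))) = kernel z (p i) (p (Suc i))" for i
      using p(1) that by (simp add: kernel_def gromov_product_def)
    hence "r = (\<Sum>i<Suc n. kernel (g z) (g (p i)) (g (p (Suc i))))"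
      by (simp add: r)
    thus "r \<in> chain_sums (g z) (g w) (g a)"
      unfolding chain_sums_def using p g by (intro CollectI exI[of _ "g \<circ> p"] exI[of _ n]) auto
  qed
  define f' where "f' = inv_into X f"
  have f: "f x \<in> X" "f' x \<in> X" "f' (f x) = x" "f (f' x) = x" if "x \<in> X" for x
    using that assms(1) unfolding f'_def
    by (auto simp: bij_betw_def inv_into_into f_inv_into_f)
  have "chain_sums z w a \<subseteq> chain_sums (f z) (f w) (f a)"
    by (rule sub) (use f iso assms in auto)
  moreover have "chain_sums (f z) (f w) (f a) \<subseteq> chain_sums (f' (f z)) (f' (f w)) (f' (f a))"
  proof (rule sub)
    show "d (f' x) (f' y) = d x y" if "x \<in> X" "y \<in> X" for x y
      using iso[of "f' x" "f' y"] f that by simp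
  qed (use f assms in auto)
  ultimately show ?thesis
    using f assms by (simp add: visual_def)
qed

section \<open>The flow between two points\<close>

text \<open>At Gromov product \<open>6 \<delta>\<close> the kernel is \<open>1/8\<close>. Anchors \<open>w\<close> that far away from \<open>z\<close>
  are close, in the visual metric at \<open>z\<close>, to the points behind them.\<close>

definition anchor_radius :: nat where
  "anchor_radius = nat \<lceil>6 * \<delta>\<rceil>"

text \<open>The anchors \<open>w\<close> near \<open>z\<close> are finitely many test points for the directions of \<open>a\<close> and \<open>x\<close> as seen
  from \<open>z\<close>. The threshold \<open>1/16\<close> is below the gap \<open>5/16 - 1/8\<close> that an anchor in the direction of \<open>x\<close>
  detects at a point \<open>z\<close> between \<open>a\<close> and \<open>x\<close>.\<close>

definition flow :: "'v \<Rightarrow> 'v \<Rightarrow> 'v \<times> 'v \<Rightarrow> real" where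
  "flow a x = (\<lambda>(z, w). if d z w \<le> anchor_radius
                 then soft_threshold (1/16) (visual z w a - visual z w x) else 0)"

lemma flow_refl: "flow a a i = 0"
  by (auto simp: flow_def soft_threshold_def split: prod.split)

lemma abs_flow_le:
  assumes "a \<in> X" "x \<in> X" "i \<in> X \<times> X"
  shows "\<bar>flow a x i\<bar> \<le> 1"
proof -
  obtain z w where i: "i = (z, w)" "z \<in> X" "w \<in> X" using assms by auto
  have "\<bar>visual z w a - visual z w x\<bar> \<le> 1"
    using visual_diff_le[of z w a x] kernel_le_1[of a x z] assms i by simp
  thus ?thesis by (auto simp: flow_def i abs_soft_threshold)
qed

lemma flow_isometry:
  assumes "bij_betw f X X" "\<And>x y. x \<in> X \<Longrightarrow> y \<in> X \<Longrightarrow> d (f x) (f y) = d x y"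
    and "z \<in> X" "w \<in> X" "a \<in> X" "x \<in> X"
  shows "flow (f a) (f x) (f z, f w) = flow a x (z, w)"
  using assms visual_isometry[of f] by (simp add: flow_def)

text \<open>This confines the flow from \<open>x\<close> to \<open>a\<close> to a neighbourhood of the geodesics between them: at
  Gromov product \<open>8 \<delta>\<close> the kernel is \<open>1/16\<close>.\<close>

lemma visual_threshold:
  assumes "z \<in> X" "w \<in> X" "a \<in> X" "x \<in> X" "8 * \<delta> \<le> gp z a x"
  shows "soft_threshold (1/16) (visual z w a - visual z w x) = 0"
proof (rule soft_threshold_eq_0)
  have "kernel z a x \<le> 2 powr (- (8 * \<delta>) / (2 * \<delta>))"
    using assms kernel_le_iff by blast
  also have "\<dots> = 1 / 16"
    using delta_pos by (simp add: powr_minus_divide powr_numeral)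
  finally show "\<bar>visual z w a - visual z w x\<bar> \<le> 1 / 16"
    using visual_diff_le[of z w a x] assms by simp
qed simp

lemma finite_flow_support:
  assumes "a \<in> X" "x \<in> X"
  shows "finite {i \<in> X \<times> X. flow a x i \<noteq> 0}"
proof (rule finite_subset)
  define r where "r = d a x + nat \<lceil>16 * \<delta>\<rceil>"
  show "finite (SIGMA z:{z \<in> X. d a z \<le> r}. {w \<in> X. d z w \<le> anchor_radius})"
    using assms by (intro finite_SigmaI finite_ball) auto
  show "{i \<in> X \<times> X. flow a x i \<noteq> 0}
        \<subseteq> (SIGMA z:{z \<in> X. d a z \<le> r}. {w \<in> X. d z w \<le> anchor_radius})"
  proof
    fix i assume i: "i \<in> {i \<in> X \<times> X. flow a x i \<noteq> 0}"
    then obtain z w where zw: "i = (z, w)" "z \<in> X" "w \<in> X" by auto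
    have "d z w \<le> anchor_radius" and "\<not> 8 * \<delta> \<le> gp z a x"
      using i zw visual_threshold[of z w a x] assms by (auto simp: flow_def split: if_splits)
    moreover from this(2) have "real (d a z) \<le> real (d a x) + 16 * \<delta>"
      using d_sym[of x z] assms zw by (simp add: gromov_product_def)
    hence "d a z \<le> r" unfolding r_def by linarith
    ultimately show "i \<in> (SIGMA z:{z \<in> X. d a z \<le> r}. {w \<in> X. d z w \<le> anchor_radius})"
      using zw by auto
  qed
qed

text \<open>For \<open>z\<close> on a geodesic from \<open>a\<close> to \<open>x\<close> let \<open>w\<close> be the anchor in the direction of \<open>x\<close>. It is
  visually close to \<open>x\<close>, and it is visually far from \<open>a\<close> because \<open>(a|x)\<^sub>z = 0\<close>.\<close>

lemma flow_lower:
  assumes "a \<in> X" "x \<in> X" "z \<in> X"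
    and "d a z + d z x = d a x" "anchor_radius \<le> d z x"
  shows "\<exists>w\<in>X. 1/8 \<le> \<bar>flow a x (z, w)\<bar>"
proof -
  obtain w where w: "w \<in> X" "d z w = anchor_radius" "d w x = d z x - anchor_radius"
    using geodesic[of z x anchor_radius] assms by auto
  have anchor: "6 * \<delta> \<le> real anchor_radius"
    unfolding anchor_radius_def by linarith
  \<comment> \<open>since \<open>w\<close> is on a geodesic from \<open>z\<close> to \<open>x\<close>\<close>
  have zw: "gp z w x = real anchor_radius"
    using w assms d_sym[of w z] d_sym[of x z] by (simp add: gromov_product_def of_nat_diff)
  have "gp z a x = 0"
    using assms d_sym[of x z] by (simp add: gromov_product_def flip: of_nat_add)
  hence "gp z a w \<le> \<delta>"
    using hyperbolic[of z a w x] zw anchor delta_pos assms w by auto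
  hence "gp z w a \<le> \<delta>"
    using gp_commute[of w a z] assms w by simp
  hence "2 powr (- \<delta> / (2 * \<delta>)) \<le> kernel z w a"
    using kernel_ge_iff by blast
  moreover have "2 powr (- \<delta> / (2 * \<delta>)) = 1 / sqrt 2"
    using delta_pos by (simp add: powr_minus_divide powr_half_sqrt)
  moreover have "5 / 8 \<le> 1 / sqrt 2"
    using real_le_lsqrt[of "8/5" 2] by (simp add: field_simps power2_eq_square)
  ultimately have "5 / 16 \<le> visual z w a"
    using visual_ge[of z w a] assms w by linarith
  moreover have "visual z w x \<le> 1 / 8"
  proof -
    have "kernel z w x \<le> 2 powr (- (6 * \<delta>) / (2 * \<delta>))"
      using zw anchor by (subst kernel_le_iff) simp
    also have "\<dots> = 1 / 8"
      using delta_pos by (simp add: powr_minus_divide powr_numeral)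
    finally show ?thesis using visual_le[of z w x] assms w by linarith
  qed
  ultimately have "1 / 8 \<le> \<bar>flow a x (z, w)\<bar>"
    using w by (simp add: flow_def abs_soft_threshold)
  thus ?thesis using w by blast
qed

lemma flow_sum_ge:
  assumes "a \<in> X" "x \<in> X"
  shows "\<exists>F\<subseteq>X \<times> X. finite F \<and> (real (d a x) - real anchor_radius) / 8 \<le> (\<Sum>i\<in>F. \<bar>flow a x i\<bar>)"
proof -
  define J where "J = {i. i + anchor_radius \<le> d a x}"
  have "\<forall>i\<in>J. \<exists>z\<in>X. \<exists>w\<in>X. d a z = i \<and> 1/8 \<le> \<bar>flow a x (z, w)\<bar>"
  proof
    fix i assume i: "i \<in> J"
    then obtain z where z: "z \<in> X" "d a z = i" "d z x = d a x - i"
      using geodesic[of a x i] assms by (auto simp: J_def)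
    have "\<exists>w\<in>X. 1/8 \<le> \<bar>flow a x (z, w)\<bar>"
      by (rule flow_lower) (use z i assms in \<open>auto simp: J_def\<close>)
    thus "\<exists>z\<in>X. \<exists>w\<in>X. d a z = i \<and> 1/8 \<le> \<bar>flow a x (z, w)\<bar>" using z by blast
  qed
  then obtain z w where zw: "\<And>i. i \<in> J \<Longrightarrow> z i \<in> X \<and> w i \<in> X \<and> d a (z i) = i \<and>
      1/8 \<le> \<bar>flow a x (z i, w i)\<bar>"
    by metis
  have J: "finite J" "real (d a x) - real anchor_radius \<le> real (card J)"
  proof -
    have "J = (if anchor_radius \<le> d a x then {..d a x - anchor_radius} else {})"
      by (auto simp: J_def)
    thus "finite J" "real (d a x) - real anchor_radius \<le> real (card J)"
      by (auto simp: of_nat_diff)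
  qed
  have inj: "inj_on (\<lambda>i. (z i, w i)) J"
    by (rule inj_onI) (metis zw prod.inject)
  define F where "F = (\<lambda>i. (z i, w i)) ` J"
  have "(real (d a x) - real anchor_radius) / 8 \<le> (\<Sum>i\<in>J. 1/8)"
    using J(2) by simp
  also have "\<dots> \<le> (\<Sum>i\<in>J. \<bar>flow a x (z i, w i)\<bar>)"
    using zw by (intro sum_mono) auto
  also have "\<dots> = (\<Sum>i\<in>F. \<bar>flow a x i\<bar>)"
    unfolding F_def using inj by (simp add: sum.reindex)
  finally show ?thesis
    using J(1) zw by (intro exI[of _ F]) (auto simp: F_def)
qed

section \<open>Mixed differences of the flow are uniformly bounded\<close>

text \<open>If \<open>z\<close> is next to a geodesic from \<open>s\<close> to \<open>x\<close>, then \<open>p\<close> branches off from it at distance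
  \<open>(p|x)\<^sub>s\<close> from \<open>s\<close>. As seen from \<open>z\<close>, the point \<open>p\<close> is on the side of \<open>s\<close> when \<open>z\<close> is beyond the
  branching point, and on the side of \<open>x\<close> otherwise; in both cases the Gromov product measures
  the distance to the branching point. This holds in any metric space, since both sides are
  combinations of the same distances.\<close>

lemma gp_shift:
  assumes "s \<in> X" "x \<in> X" "p \<in> X" "z \<in> X"
  shows "gp z s p - gp z x p = real (d s z) - gp s p x - gp z s x"
  using assms d_sym[of p s] d_sym[of x s] d_sym[of x p] d_sym[of x z]
  by (simp add: gromov_product_def field_simps)

lemma kernel_le_exp:
  assumes "g \<le> gp z a b + 8 * \<delta>"
  shows "kernel z a b \<le> 16 * 2 powr (- g / (2 * \<delta>))"
proof -
  have "- gp z a b / (2 * \<delta>) \<le> 4 + - g / (2 * \<delta>)"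
    using assms delta_pos by (simp add: field_simps)
  hence "kernel z a b \<le> 2 powr (4 + - g / (2 * \<delta>))"
    unfolding kernel_def by (intro powr_mono) auto
  also have "\<dots> = 16 * 2 powr (- g / (2 * \<delta>))"
    by (simp only: powr_add) (simp add: powr_numeral)
  finally show ?thesis .
qed

text \<open>If \<open>t\<close> is on the side of \<open>s\<close>, the variation from \<open>s\<close> to \<open>t\<close> is small; if \<open>y\<close> is on the side
  of \<open>x\<close>, that from \<open>x\<close> to \<open>y\<close> is. In the remaining case \<open>y\<close> is on the side of \<open>s\<close> and
  \<open>t\<close> on the side of \<open>x\<close>, and the values cancel by oddness.\<close>

lemma mixed_difference_near_geodesic:
  assumes X: "s \<in> X" "t \<in> X" "x \<in> X" "y \<in> X" "z \<in> X" "w \<in> X" and near: "gp z s x \<le> 8 * \<delta>"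
  shows "\<bar>flow s x (z, w) - flow s y (z, w) - flow t x (z, w) + flow t y (z, w)\<bar>
    \<le> (if d z w \<le> anchor_radius then
         32 * (2 powr (- (1 / (2 * \<delta>)) * \<bar>real (d s z) - gp s t x\<bar>)
             + 2 powr (- (1 / (2 * \<delta>)) * \<bar>real (d s z) - gp s y x\<bar>)) else 0)"
proof (cases "d z w \<le> anchor_radius")
  case False
  thus ?thesis by (simp add: flow_def)
next
  case True
  define D where "D = flow s x (z, w) - flow s y (z, w) - flow t x (z, w) + flow t y (z, w)"
  define e where "e p = 2 powr (- (1 / (2 * \<delta>)) * \<bar>real (d s z) - gp s p x\<bar>)" for p
  have e_eq: "e p = 2 powr (- \<bar>real (d s z) - gp s p x\<bar> / (2 * \<delta>))" for p
    by (simp add: e_def)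
  have e_pos: "0 < e p" for p by (simp add: e_def)
  \<comment> \<open>by \<open>gp_shift\<close> and since Gromov products are nonnegative\<close>
  have behind: "kernel z s p \<le> 16 * e p" if "p \<in> X" "gp s p x \<le> real (d s z)" for p
    unfolding e_eq using gp_shift[of s x p z] gp_nonneg[of x p z] X that near
    by (intro kernel_le_exp) auto
  have ahead: "kernel z x p \<le> 16 * e p" if "p \<in> X" "real (d s z) \<le> gp s p x" for p
    unfolding e_eq using gp_shift[of s x p z] gp_nonneg[of s p z] gp_nonneg[of s x z] X that delta_pos
    by (intro kernel_le_exp) auto
  note mixed = soft_threshold_mixed_difference[of "1/16" "visual z w s" "visual z w x"
      "visual z w y" "visual z w t", simplified]
  have D_st: "\<bar>D\<bar> \<le> 2 * kernel z s t" and D_xy: "\<bar>D\<bar> \<le> 2 * kernel z x y"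
    using mixed(1,2) visual_diff_le[of z w s t] visual_diff_le[of z w x y] X True
    unfolding D_def flow_def by simp_all
  have D_sytx: "\<bar>D\<bar> \<le> 2 * (kernel z s y + kernel z x t)"
  proof -
    have "D = - (soft_threshold (1/16) (visual z w s - visual z w y)
        - soft_threshold (1/16) (visual z w s - visual z w x)
        - soft_threshold (1/16) (visual z w t - visual z w y)
        + soft_threshold (1/16) (visual z w t - visual z w x))"
      using True by (simp add: D_def flow_def)
    hence "\<bar>D\<bar> \<le> 2 * (\<bar>visual z w s - visual z w y\<bar> + \<bar>visual z w t - visual z w x\<bar>)"
      using soft_threshold_mixed_difference(3)[of "1/16"] by (simp only: abs_minus_cancel)
    thus ?thesis
      using visual_diff_le[of z w s y] visual_diff_le[of z w t x] kernel_commute[of t x z] X by simp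
  qed
  have "\<bar>D\<bar> \<le> 32 * (e t + e y)"
  proof (cases "gp s t x \<le> real (d s z)")
    case True
    thus ?thesis using D_st behind[OF X(2) True] e_pos[of y] by argo
  next
    case t: False
    show ?thesis
    proof (cases "gp s y x \<le> real (d s z)")
      case True
      thus ?thesis using D_sytx behind[OF X(4) True] ahead[OF X(2)] t by argo
    next
      case False
      thus ?thesis using D_xy ahead[OF X(4)] False e_pos[of t] by argo
    qed
  qed
  thus ?thesis using True by (simp add: D_def e_def)
qed

text \<open>By \<open>gp z s x \<le> 8 \<delta>\<close>, each of the points has Gromov product at least \<open>i - 8 \<delta>\<close> with \<open>x\<close>, based
  at \<open>s\<close>. Hyperbolicity gives \<open>i - 9 \<delta>\<close> for any two of them, hence distance at most \<open>18 \<delta>\<close>.\<close>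

lemma card_near_geodesic:
  assumes "s \<in> X" "x \<in> X"
  defines "r \<equiv> nat \<lceil>18 * \<delta>\<rceil>"
  assumes "finite Z" "Z \<subseteq> X" "\<And>z. z \<in> Z \<Longrightarrow> d s z = i \<and> gp z s x \<le> 8 * \<delta>"
  shows "card Z \<le> N r"
proof (cases "Z = {}")
  case False
  then obtain z where z: "z \<in> Z" by auto
  have "Z \<subseteq> {y \<in> X. d z y \<le> r}"
  proof
    fix y assume y: "y \<in> Z"
    have X: "z \<in> X" "y \<in> X" using y z assms by auto
    have "gp s u x = real i - gp u s x" if "u \<in> Z" for u
      using assms that d_sym[of x s] d_sym[of u s] d_sym[of x u]
      by (auto simp: gromov_product_def field_simps subset_iff)
    hence "real i - 8 * \<delta> \<le> gp s u x" if "u \<in> Z" for u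
      using that assms by fastforce
    from this[OF y] this[OF z] have "real i - 9 * \<delta> \<le> gp s z y"
      using hyperbolic[of s z x y] gp_commute[of y x s] assms(1,2) X by (auto simp: min_def split: if_splits)
    moreover have "real (d z y) = 2 * real i - 2 * gp s z y"
      using y z X assms d_sym[of z s] d_sym[of y s] by (simp add: gromov_product_def field_simps)
    ultimately have "real (d z y) \<le> 18 * \<delta>" by simp
    thus "y \<in> {y \<in> X. d z y \<le> r}" using X unfolding r_def by simp linarith
  qed
  hence "card Z \<le> card {y \<in> X. d z y \<le> r}"
    using finite_ball[of z r] z assms by (intro card_mono) auto
  thus ?thesis using card_ball[of z r] z assms by fastforce
qed simp

lemma sum_near_geodesic:
  assumes "s \<in> X" "x \<in> X" "finite F" "F \<subseteq> X \<times> X"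
  shows "(\<Sum>(z, w)\<in>F. if gp z s x \<le> 8 * \<delta> \<and> d z w \<le> anchor_radius
            then 2 powr (- (1 / (2 * \<delta>)) * \<bar>real (d s z) - m\<bar>) else 0)
    \<le> real (N anchor_radius) * (real (N (nat \<lceil>18 * \<delta>\<rceil>)) * (2 / (1 - 2 powr (- (1 / (2 * \<delta>))))))"
    (is "?lhs \<le> _")
proof -
  define e where "e i = 2 powr (- (1 / (2 * \<delta>)) * \<bar>real i - m\<bar>)" for i :: nat
  define Z where "Z = {z \<in> fst ` F. gp z s x \<le> 8 * \<delta>}"
  define W where "W z = {w \<in> X. d z w \<le> anchor_radius}" for z
  have Z: "finite Z" "Z \<subseteq> X" using assms by (auto simp: Z_def)
  have W: "finite (W z)" "card (W z) \<le> N anchor_radius" if "z \<in> Z" for z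
    unfolding W_def using finite_ball card_ball that Z by auto
  define F' where "F' = {(z, w) \<in> F. gp z s x \<le> 8 * \<delta> \<and> d z w \<le> anchor_radius}"
  have "?lhs = (\<Sum>(z, w)\<in>F'. e (d s z))"
    unfolding F'_def using assms(3)
    by (intro sum.mono_neutral_cong_right) (auto simp: e_def split: if_splits)
  also have "\<dots> \<le> (\<Sum>(z, w)\<in>Sigma Z W. e (d s z))"
  proof (rule sum_mono2)
    show "finite (Sigma Z W)" using Z W by blast
    show "F' \<subseteq> Sigma Z W"
      using assms(4) by (force simp: F'_def Z_def W_def)
  qed (auto simp: e_def)
  also have "\<dots> = (\<Sum>z\<in>Z. \<Sum>w\<in>W z. e (d s z))"
    using Z W by (subst sum.Sigma) auto
  also have "\<dots> \<le> (\<Sum>z\<in>Z. real (N anchor_radius) * e (d s z))"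
    using W by (intro sum_mono) (auto simp: e_def intro!: mult_right_mono)
  also have "\<dots> = real (N anchor_radius) * (\<Sum>z\<in>Z. e (d s z))"
    by (simp add: sum_distrib_left)
  also have "(\<Sum>z\<in>Z. e (d s z)) = (\<Sum>i\<in>d s ` Z. \<Sum>z\<in>{z \<in> Z. d s z = i}. e (d s z))"
    using Z(1) by (rule sum.image_gen)
  also have "\<dots> \<le> (\<Sum>i\<in>d s ` Z. real (N (nat \<lceil>18 * \<delta>\<rceil>)) * e i)"
  proof (rule sum_mono)
    fix i
    have "card {z \<in> Z. d s z = i} \<le> N (nat \<lceil>18 * \<delta>\<rceil>)"
      using assms Z by (intro card_near_geodesic[of s x _ i]) (auto simp: Z_def)
    thus "(\<Sum>z\<in>{z \<in> Z. d s z = i}. e (d s z)) \<le> real (N (nat \<lceil>18 * \<delta>\<rceil>)) * e i"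
      by (simp add: e_def)
  qed
  also have "\<dots> \<le> real (N (nat \<lceil>18 * \<delta>\<rceil>)) * (2 / (1 - 2 powr (- (1 / (2 * \<delta>)))))"
    unfolding e_def sum_distrib_left[symmetric]
    using delta_pos Z by (intro mult_left_mono sum_two_sided_geometric_le) auto
  finally show ?thesis by (simp add: mult_left_mono)
qed

text \<open>The mixed difference at \<open>z\<close> vanishes unless \<open>z\<close> is next to a geodesic from \<open>s\<close> or \<open>t\<close> to \<open>x\<close>
  or \<open>y\<close>. Up to sign it is invariant under exchanging \<open>s\<close> with \<open>t\<close> and \<open>x\<close> with \<open>y\<close>, which reduces
  all four cases to a geodesic from \<open>s\<close> to \<open>x\<close>.\<close>

lemma mixed_difference_bounded:
  "\<exists>C. \<forall>s\<in>X. \<forall>t\<in>X. \<forall>x\<in>X. \<forall>y\<in>X. \<forall>F. finite F \<longrightarrow> F \<subseteq> X \<times> X \<longrightarrow>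
      (\<Sum>i\<in>F. \<bar>flow s x i - flow s y i - flow t x i + flow t y i\<bar>) \<le> C"
proof -
  define B where "B = real (N anchor_radius) *
      (real (N (nat \<lceil>18 * \<delta>\<rceil>)) * (2 / (1 - 2 powr (- (1 / (2 * \<delta>))))))"
  define D where "D s t x y i = \<bar>flow s x i - flow s y i - flow t x i + flow t y i\<bar>" for s t x y i
  define e where "e s x m = (\<lambda>(z, w). if gp z s x \<le> 8 * \<delta> \<and> d z w \<le> anchor_radius
            then 2 powr (- (1 / (2 * \<delta>)) * \<bar>real (d s z) - m\<bar>) else 0)" for s x m
  define E where "E s t x y i = 32 * (e s x (gp s t x) i + e s x (gp s y x) i)" for s t x y i
  have E_nonneg: "0 \<le> E s t x y i" for s t x y i
    by (auto simp: E_def e_def split: prod.split)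
  have D_swap: "D t s x y i = D s t x y i" "D s t y x i = D s t x y i" for s t x y i
    by (auto simp: D_def)
  have near: "D s t x y (z, w) \<le> E s t x y (z, w)"
    if "s \<in> X" "t \<in> X" "x \<in> X" "y \<in> X" "z \<in> X" "w \<in> X" "gp z s x \<le> 8 * \<delta>" for s t x y z w
    using mixed_difference_near_geodesic[OF that] that unfolding D_def E_def e_def by auto
  have pointwise: "D s t x y i \<le> E s t x y i + E s t y x i + E t s x y i + E t s y x i"
    if X: "s \<in> X" "t \<in> X" "x \<in> X" "y \<in> X" "i \<in> X \<times> X" for s t x y i
  proof -
    obtain z w where i: "i = (z, w)" "z \<in> X" "w \<in> X" using X by auto
    note nonneg = E_nonneg[of s t x y i] E_nonneg[of s t y x i] E_nonneg[of t s x y i]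
      E_nonneg[of t s y x i]
    consider "gp z s x \<le> 8 * \<delta>" | "gp z s y \<le> 8 * \<delta>" | "gp z t x \<le> 8 * \<delta>" | "gp z t y \<le> 8 * \<delta>"
      | "8 * \<delta> \<le> gp z s x" "8 * \<delta> \<le> gp z s y" "8 * \<delta> \<le> gp z t x" "8 * \<delta> \<le> gp z t y"
      by linarith
    thus ?thesis
    proof cases
      case 1
      thus ?thesis using near[of s t x y z w] X i nonneg by auto
    next
      case 2
      thus ?thesis using near[of s t y x z w] X i nonneg D_swap by auto
    next
      case 3
      thus ?thesis using near[of t s x y z w] X i nonneg D_swap by auto
    next
      case 4
      thus ?thesis using near[of t s y x z w] X i nonneg D_swap by auto
    next
      case 5
      hence "D s t x y i = 0"
        using visual_threshold X i by (auto simp: D_def flow_def)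
      thus ?thesis using nonneg by simp
    qed
  qed
  have E_sum: "(\<Sum>i\<in>F. E s t x y i) \<le> 64 * B"
    if "s \<in> X" "x \<in> X" "finite F" "F \<subseteq> X \<times> X" for s t x y F
  proof -
    have "(\<Sum>i\<in>F. e s x m i) \<le> B" for m
      using sum_near_geodesic[of s x F m] that unfolding e_def B_def by simp
    from this[of "gp s t x"] this[of "gp s y x"] show ?thesis
      unfolding E_def by (simp add: sum.distrib flip: sum_distrib_left)
  qed
  have "(\<Sum>i\<in>F. D s t x y i) \<le> 256 * B"
    if X: "s \<in> X" "t \<in> X" "x \<in> X" "y \<in> X" "finite F" "F \<subseteq> X \<times> X" for s t x y F
  proof -
    have "(\<Sum>i\<in>F. D s t x y i)
        \<le> (\<Sum>i\<in>F. E s t x y i + E s t y x i + E t s x y i + E t s y x i)"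
      using X by (intro sum_mono pointwise) auto
    also have "\<dots> \<le> 64 * B + 64 * B + 64 * B + 64 * B"
      unfolding sum.distrib using X by (intro add_mono E_sum) auto
    finally show ?thesis by simp
  qed
  thus ?thesis
    unfolding D_def by (intro exI[of _ "256 * B"] ballI allI impI) auto
qed

end

section \<open>Word metrics of hyperbolic groups\<close>

context group
begin

lemma sym_cayley_edges: "sym (cayley_edges G S)"
  by (auto simp: cayley_edges_def sym_def)

lemma cayley_edges_translate:
  assumes "S \<subseteq> carrier G" "g \<in> carrier G" "(x, y) \<in> cayley_edges G S"
  shows "(g \<otimes> x, g \<otimes> y) \<in> cayley_edges G S"
  using assms by (auto simp: cayley_edges_def m_assoc subset_iff)

lemma cayley_path_translate:
  assumes "S \<subseteq> carrier G" "g \<in> carrier G" "(x, y) \<in> cayley_edges G S ^^ n"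
  shows "(g \<otimes> x, g \<otimes> y) \<in> cayley_edges G S ^^ n"
  using assms(3) by (induction n arbitrary: y) (auto intro: cayley_edges_translate[OF assms(1,2)])

lemma cayley_path_closed:
  "(x, y) \<in> cayley_edges G S ^^ n \<Longrightarrow> x \<in> carrier G \<Longrightarrow> y \<in> carrier G"
  by (cases n) (auto simp: cayley_edges_def)

lemma cayley_path_sym: "(x, y) \<in> cayley_edges G S ^^ n \<Longrightarrow> (y, x) \<in> cayley_edges G S ^^ n"
proof (induction n arbitrary: x y)
  case (Suc n)
  then obtain z where "(x, z) \<in> cayley_edges G S ^^ n" "(z, y) \<in> cayley_edges G S" by auto
  hence "(z, x) \<in> cayley_edges G S ^^ n" "(y, z) \<in> cayley_edges G S"
    using Suc.IH sym_cayley_edges by (auto dest: symD)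
  thus ?case by (intro relpow_Suc_I2)
qed auto

lemma cayley_connected:
  assumes S: "S \<subseteq> carrier G" "generate G S = carrier G" and xy: "x \<in> carrier G" "y \<in> carrier G"
  shows "\<exists>n. (x, y) \<in> cayley_edges G S ^^ n"
proof -
  have from_one: "\<exists>n. (\<one>, h) \<in> cayley_edges G S ^^ n" if "h \<in> generate G S" for h
    using that
  proof (induction rule: generate.induct)
    case one
    show ?case by (rule exI[of _ 0]) simp
  next
    case (incl h)
    have "(\<one>, h) \<in> cayley_edges G S"
      unfolding cayley_edges_def using incl S(1) by (auto intro!: bexI[of _ h])
    thus ?case by (intro exI[of _ 1]) simp
  next
    case (inv h)
    have "(\<one>, inv h) \<in> cayley_edges G S"
      unfolding cayley_edges_def using inv S(1) by (auto intro!: bexI[of _ h])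
    thus ?case by (intro exI[of _ 1]) simp
  next
    case (eng h1 h2)
    then obtain n1 n2 where n: "(\<one>, h1) \<in> cayley_edges G S ^^ n1" "(\<one>, h2) \<in> cayley_edges G S ^^ n2"
      by auto
    have "h1 \<in> carrier G" using eng S(2) by simp
    hence "(h1, h1 \<otimes> h2) \<in> cayley_edges G S ^^ n2"
      using cayley_path_translate[OF S(1) _ n(2)] by fastforce
    thus ?case using n(1) by (intro exI[of _ "n1 + n2"]) (auto simp: relpow_add)
  qed
  have "inv x \<otimes> y \<in> generate G S" using S(2) xy by simp
  then obtain n where "(\<one>, inv x \<otimes> y) \<in> cayley_edges G S ^^ n" using from_one by blast
  hence "(x \<otimes> \<one>, x \<otimes> (inv x \<otimes> y)) \<in> cayley_edges G S ^^ n"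
    using cayley_path_translate[OF S(1) xy(1)] by blast
  thus ?thesis using xy by (auto simp flip: m_assoc)
qed

lemma finite_cayley_sphere:
  assumes "finite S" "S \<subseteq> carrier G"
  shows "finite {y. (x, y) \<in> cayley_edges G S ^^ n}"
proof (induction n)
  case (Suc n)
  have "{y. (x, y) \<in> cayley_edges G S ^^ Suc n}
      \<subseteq> (\<Union>z\<in>{z. (x, z) \<in> cayley_edges G S ^^ n}. (\<lambda>s. z \<otimes> s) ` S \<union> (\<lambda>s. z \<otimes> inv s) ` S)"
  proof
    fix y assume "y \<in> {y. (x, y) \<in> cayley_edges G S ^^ Suc n}"
    then obtain z where z: "(x, z) \<in> cayley_edges G S ^^ n" "(z, y) \<in> cayley_edges G S" by auto
    from z(2) obtain s where s: "s \<in> S" "y \<in> carrier G" "y = z \<otimes> s \<or> z = y \<otimes> s"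
      by (auto simp: cayley_edges_def)
    hence "y = z \<otimes> s \<or> y = z \<otimes> inv s"
      using assms(2) by (auto simp: m_assoc subset_iff)
    thus "y \<in> (\<Union>z\<in>{z. (x, z) \<in> cayley_edges G S ^^ n}. (\<lambda>s. z \<otimes> s) ` S \<union> (\<lambda>s. z \<otimes> inv s) ` S)"
      using z(1) s(1) by blast
  qed
  moreover have "finite (\<Union>z\<in>{z. (x, z) \<in> cayley_edges G S ^^ n}.
      (\<lambda>s. z \<otimes> s) ` S \<union> (\<lambda>s. z \<otimes> inv s) ` S)"
    using Suc assms(1) by auto
  ultimately show ?case by (rule finite_subset)
qed auto

end

lemma hyperbolic_group_word_metric:
  fixes G (structure)
  assumes "hyperbolic_group G"
  obtains d \<delta> N where "hyperbolic_graph_metric (carrier G) d \<delta> N"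
    and "\<And>g x y. g \<in> carrier G \<Longrightarrow> x \<in> carrier G \<Longrightarrow> y \<in> carrier G \<Longrightarrow>
           d (g \<otimes> x) (g \<otimes> y) = d x y"
proof -
  obtain S where "group G" and S: "finite S" "S \<subseteq> carrier G" "generate G S = carrier G"
    and hyp: "gromov_hyperbolic (carrier G) (\<lambda>x y. real (graph_dist (cayley_edges G S) x y))"
    using assms unfolding hyperbolic_group_def by blast
  interpret group G by fact
  define R where "R = cayley_edges G S"
  define d where "d = graph_dist R"
  have path: "(x, y) \<in> R ^^ d x y" if "x \<in> carrier G" "y \<in> carrier G" for x y
    unfolding d_def graph_dist_def R_def using cayley_connected[OF S(2,3) that] by (rule LeastI_ex)
  have d_le: "d x y \<le> n" if "(x, y) \<in> R ^^ n" for x y n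
    unfolding d_def graph_dist_def using that by (rule Least_le)
  have triangle: "d x z \<le> d x y + d y z"
    if "x \<in> carrier G" "y \<in> carrier G" "z \<in> carrier G" for x y z
    using path[of x y] path[of y z] that by (intro d_le) (auto simp: relpow_add)
  have translate_le: "d (g \<otimes> x) (g \<otimes> y) \<le> d x y"
    if "g \<in> carrier G" "x \<in> carrier G" "y \<in> carrier G" for g x y
    using path[of x y] that cayley_path_translate[OF S(2)] unfolding R_def[symmetric] by (intro d_le) auto
  have translate: "d (g \<otimes> x) (g \<otimes> y) = d x y"
    if "g \<in> carrier G" "x \<in> carrier G" "y \<in> carrier G" for g x y
    using translate_le[of g x y] translate_le[of "inv g" "g \<otimes> x" "g \<otimes> y"] that
    by (simp flip: m_assoc)
  have ball: "finite {y \<in> carrier G. d x y \<le> r}" if "x \<in> carrier G" for x r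
  proof (rule finite_subset)
    show "{y \<in> carrier G. d x y \<le> r} \<subseteq> (\<Union>n\<le>r. {y. (x, y) \<in> R ^^ n})"
      using path that by auto
    show "finite (\<Union>n\<le>r. {y. (x, y) \<in> R ^^ n})"
      unfolding R_def using finite_cayley_sphere[OF S(1,2)] by blast
  qed
  obtain \<delta>0 where \<delta>0: "\<And>w x y z. w \<in> carrier G \<Longrightarrow> x \<in> carrier G \<Longrightarrow> y \<in> carrier G \<Longrightarrow> z \<in> carrier G \<Longrightarrow>
      gromov_product (\<lambda>x y. real (d x y)) w x z
      \<ge> min (gromov_product (\<lambda>x y. real (d x y)) w x y)
            (gromov_product (\<lambda>x y. real (d x y)) w y z) - \<delta>0"
    using hyp unfolding gromov_hyperbolic_def d_def R_def by blast
  \<comment> \<open>the constant is enlarged because the visual metrics have the rate \<open>1/(2\<delta>)\<close>\<close>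
  define \<delta> where "\<delta> = max 1 \<delta>0"
  define N where "N r = card {y \<in> carrier G. d \<one> y \<le> r}" for r
  have "hyperbolic_graph_metric (carrier G) d \<delta> N"
  proof
    show "d x y = d y x" if "x \<in> carrier G" "y \<in> carrier G" for x y
      using path[of x y] path[of y x] d_le that cayley_path_sym unfolding R_def by (meson le_antisym)
    show "\<exists>z\<in>carrier G. d x z = i \<and> d z y = d x y - i"
      if "x \<in> carrier G" "y \<in> carrier G" "i \<le> d x y" for x y i
    proof -
      have "(x, y) \<in> R ^^ (i + (d x y - i))" using path[of x y] that by simp
      then obtain z where z: "(x, z) \<in> R ^^ i" "(z, y) \<in> R ^^ (d x y - i)"
        by (auto simp: relpow_add)
      moreover have "z \<in> carrier G"
        using z(1) that cayley_path_closed unfolding R_def by blast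
      ultimately show ?thesis
        using d_le[OF z(1)] d_le[OF z(2)] triangle[of x z y] that by (intro bexI[of _ z]) auto
    qed
    show "card {y \<in> carrier G. d x y \<le> r} \<le> N r" if "x \<in> carrier G" for x r
      unfolding N_def
    proof (rule card_inj_on_le)
      show "inj_on (\<lambda>y. inv x \<otimes> y) {y \<in> carrier G. d x y \<le> r}"
        using that by (intro inj_onI) auto
      show "(\<lambda>y. inv x \<otimes> y) ` {y \<in> carrier G. d x y \<le> r} \<subseteq> {y \<in> carrier G. d \<one> y \<le> r}"
      proof (rule image_subsetI)
        fix y assume "y \<in> {y \<in> carrier G. d x y \<le> r}"
        thus "inv x \<otimes> y \<in> {y \<in> carrier G. d \<one> y \<le> r}"
          using translate[of "inv x" x y] that by simp
      qed
      show "finite {y \<in> carrier G. d \<one> y \<le> r}" by (rule ball) simp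
    qed
    show "0 < \<delta>" by (simp add: \<delta>_def)
    show "min (gromov_product (\<lambda>x y. real (d x y)) w x y)
              (gromov_product (\<lambda>x y. real (d x y)) w y z) - \<delta>
          \<le> gromov_product (\<lambda>x y. real (d x y)) w x z"
      if "w \<in> carrier G" "x \<in> carrier G" "y \<in> carrier G" "z \<in> carrier G" for w x y z
      using \<delta>0[OF that] unfolding \<delta>_def by linarith
  qed (use ball triangle in auto)
  thus ?thesis using translate that by blast
qed

section \<open>Closed subspaces of integrable functions\<close>

lemma integrable_weighted:
  fixes f c :: "'x \<Rightarrow> real"
  assumes "integrable M f" "c \<in> borel_measurable M" "\<And>x. \<bar>c x\<bar> \<le> 1"
  shows "integrable M (\<lambda>x. c x * f x)"
proof (rule Bochner_Integration.integrable_bound[OF assms(1)])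
  show "AE x in M. norm (c x * f x) \<le> norm (f x)"
    using assms(3) by (auto simp: abs_mult intro!: mult_left_le_one_le)
qed (use assms in auto)

lemma integral_weighted_rep:
  fixes f c :: "'x \<Rightarrow> real"
  assumes "integrable M f" "c \<in> borel_measurable M"
  shows "(\<integral>x. c x * L1_rep (L1_class M f) x \<partial>M) = (\<integral>x. c x * f x \<partial>M)"
  using L1_rep_class[OF assms(1)] assms by (intro integral_cong_AE) auto

text \<open>A bounded function \<open>c\<close> defines the continuous functional \<open>u \<mapsto> \<integral> c u\<close>, which is \<open>1\<close>-Lipschitz for
  \<open>\<bar>c\<bar> \<le> 1\<close>; therefore the set where some functional does not vanish is open.\<close>

lemma L1_closed_subspace_annihilator:
  assumes C: "\<And>c. c \<in> C \<Longrightarrow> c \<in> borel_measurable M" "\<And>c x. c \<in> C \<Longrightarrow> \<bar>c x\<bar> \<le> 1"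
  shows "L1_closed_subspace M {u \<in> L1_space M. \<forall>c\<in>C. (\<integral>x. c x * L1_rep u x \<partial>M) = 0}"
    (is "L1_closed_subspace M ?E")
proof -
  note rep = integral_weighted_rep[OF _ C(1)]
  have int: "integrable M (\<lambda>x. c x * f x)" if "integrable M f" "c \<in> C" for c f
    using that C by (intro integrable_weighted)
  interpret Metric_space "L1_space M" "L1_dist M" by (rule Metric_space_L1)
  have E_sub: "?E \<subseteq> L1_space M" by auto
  have zero: "L1_zero M \<in> ?E"
    unfolding L1_zero_def by (auto simp: rep intro: L1_class_in_space)
  have add: "L1_add M u v \<in> ?E" if uv: "u \<in> ?E" "v \<in> ?E" for u v
  proof -
    obtain f where f: "integrable M f" "u = L1_class M f" using uv by (auto elim: L1_space_cases)
    obtain g where g: "integrable M g" "v = L1_class M g" using uv by (auto elim: L1_space_cases)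
    have "(\<integral>x. c x * (f x + g x) \<partial>M) = 0" if "c \<in> C" for c
      using uv f g that int[OF f(1) that] int[OF g(1) that] by (simp add: rep distrib_left)
    thus ?thesis using f g by (auto simp: L1_add_class rep intro: L1_class_in_space)
  qed
  have scale: "L1_scale M k u \<in> ?E" if u: "u \<in> ?E" for k u
  proof -
    obtain f where f: "integrable M f" "u = L1_class M f" using u by (auto elim: L1_space_cases)
    have "(\<integral>x. c x * (k * f x) \<partial>M) = 0" if "c \<in> C" for c
      using u f that by (simp add: rep mult.left_commute)
    thus ?thesis using f by (auto simp: L1_scale_class rep intro: L1_class_in_space)
  qed
  have "openin mtopology (L1_space M - ?E)"
    unfolding openin_mtopology
  proof (intro conjI allI impI)
    fix u assume u: "u \<in> L1_space M - ?E"
    then obtain c where c: "c \<in> C" "(\<integral>x. c x * L1_rep u x \<partial>M) \<noteq> 0" by auto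
    define r where "r = \<bar>\<integral>x. c x * L1_rep u x \<partial>M\<bar>"
    have "mball u r \<subseteq> L1_space M - ?E"
    proof
      fix v assume v: "v \<in> mball u r"
      obtain f where f: "integrable M f" "u = L1_class M f" using u by (auto elim: L1_space_cases)
      obtain g where g: "integrable M g" "v = L1_class M g" using v by (auto elim: L1_space_cases)
      have "\<bar>\<integral>x. c x * (f x - g x) \<partial>M\<bar> \<le> (\<integral>x. \<bar>c x * (f x - g x)\<bar> \<partial>M)"
        using integral_norm_bound[of M "\<lambda>x. c x * (f x - g x)"] by simp
      also have "\<dots> \<le> (\<integral>x. \<bar>f x - g x\<bar> \<partial>M)"
        using f g c C(2)[OF c(1)]
        by (intro integral_mono integrable_abs int)
           (auto simp: abs_mult intro!: mult_left_le_one_le)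
      also have "\<dots> < r" using v f g by (simp add: L1_dist_class)
      finally have "(\<integral>x. c x * g x \<partial>M) \<noteq> 0"
        using f g c int[OF f(1) c(1)] int[OF g(1) c(1)]
        by (auto simp: r_def rep right_diff_distrib)
      thus "v \<in> L1_space M - ?E" using v g c(1) by (auto simp: rep)
    qed
    moreover have "0 < r" using c(2) by (simp add: r_def)
    ultimately show "\<exists>r>0. mball u r \<subseteq> L1_space M - ?E" by blast
  qed auto
  hence "closedin mtopology ?E" using E_sub by (simp add: closedin_def)
  thus ?thesis
    unfolding L1_closed_subspace_def using E_sub zero add scale by blast
qed

lemma operator_norm_le:
  assumes "\<And>u. u \<in> E \<Longrightarrow> L1_norm M (T u) \<le> K * L1_norm M u" "0 \<le> K" "L1_zero M \<in> E"
  shows "operator_norm M E T \<le> K"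
  unfolding operator_norm_def
proof (rule cSUP_least)
  have "L1_norm M (L1_zero M) = 0"
    by (simp add: L1_zero_def L1_norm_class)
  thus "{u \<in> E. L1_norm M u \<le> 1} \<noteq> {}" using assms(3) by force
  fix u assume u: "u \<in> {u \<in> E. L1_norm M u \<le> 1}"
  hence "L1_norm M (T u) \<le> K * L1_norm M u" using assms(1) by blast
  also have "\<dots> \<le> K" using u assms(2) by (simp add: mult_left_le)
  finally show "L1_norm M (T u) \<le> K" .
qed

section \<open>Counting measures and absolutely summable families\<close>

lemma integrable_count_space_iff:
  fixes f :: "'x \<Rightarrow> real"
  shows "integrable (count_space A) f \<longleftrightarrow> (\<lambda>x. \<bar>f x\<bar>) summable_on A"
  using abs_summable_equivalent[of f A] by (simp add: Infinite_Set_Sum.abs_summable_on_def)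

lemma integral_count_space_infsum:
  fixes f :: "'x \<Rightarrow> real"
  assumes "(\<lambda>x. \<bar>f x\<bar>) summable_on A"
  shows "(\<integral>x. f x \<partial>count_space A) = infsum f A"
  using infsetsum_infsum[of f A] abs_summable_equivalent[of f A] assms
  by (simp add: infsetsum_def)

lemma L1_rep_count_space:
  assumes "integrable (count_space UNIV) f"
  shows "L1_rep (L1_class (count_space UNIV) f) = f"
  using L1_rep_class(2)[OF assms] by (auto simp: AE_count_space)

text \<open>For functions supported on two disjoint coded copies of index sets; the action space below is
  \<open>\<ell>\<^sup>1(\<Gamma>) \<oplus> \<ell>\<^sup>1(\<Gamma> \<times> \<Gamma>)\<close>.\<close>

lemma infsum_two_parts:
  fixes g :: "'r \<Rightarrow> real"
  assumes inj: "inj_on p A" "inj_on q B" and disj: "p ` A \<inter> q ` B = {}"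
    and zero: "\<And>r. r \<notin> p ` A \<union> q ` B \<Longrightarrow> g r = 0"
    and sum: "(\<lambda>x. g (p x)) summable_on A" "(\<lambda>i. g (q i)) summable_on B"
  shows "g summable_on UNIV" "infsum g UNIV = (\<Sum>\<^sub>\<infinity>x\<in>A. g (p x)) + (\<Sum>\<^sub>\<infinity>i\<in>B. g (q i))"
proof -
  have A: "g summable_on p ` A" using summable_on_reindex[OF inj(1), of g] sum(1) by (simp add: o_def)
  have B: "g summable_on q ` B" using summable_on_reindex[OF inj(2), of g] sum(2) by (simp add: o_def)
  have "g summable_on (p ` A \<union> q ` B)" using A B by (rule summable_on_union)
  thus "g summable_on UNIV"
    using zero by (subst summable_on_cong_neutral[where T = "p ` A \<union> q ` B" and g = g]) auto
  have "infsum g UNIV = infsum g (p ` A \<union> q ` B)"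
    using zero by (intro infsum_cong_neutral) auto
  also have "\<dots> = infsum g (p ` A) + infsum g (q ` B)"
    using A B disj by (rule infsum_Un_disjoint)
  finally show "infsum g UNIV = (\<Sum>\<^sub>\<infinity>x\<in>A. g (p x)) + (\<Sum>\<^sub>\<infinity>i\<in>B. g (q i))"
    using inj by (simp add: infsum_reindex o_def)
qed

lemma summable_on_part:
  fixes g :: "'r \<Rightarrow> real"
  assumes "inj_on p A" "g summable_on UNIV"
  shows "(\<lambda>x. g (p x)) summable_on A"
proof -
  have "g summable_on p ` A" using assms(2) by (rule summable_on_subset_banach) simp
  thus ?thesis using summable_on_reindex[OF assms(1), of g] by (simp add: o_def)
qed

lemma abs_summable_imp_summable:
  fixes f :: "'x \<Rightarrow> real"
  shows "(\<lambda>x. \<bar>f x\<bar>) summable_on A \<Longrightarrow> f summable_on A"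
  using abs_summable_summable[of f A] by simp

lemma abs_summable_add:
  fixes f g :: "'x \<Rightarrow> real"
  assumes "(\<lambda>x. \<bar>f x\<bar>) summable_on A" "(\<lambda>x. \<bar>g x\<bar>) summable_on A"
  shows "(\<lambda>x. \<bar>f x + g x\<bar>) summable_on A"
    and "(\<Sum>\<^sub>\<infinity>x\<in>A. \<bar>f x + g x\<bar>) \<le> (\<Sum>\<^sub>\<infinity>x\<in>A. \<bar>f x\<bar>) + (\<Sum>\<^sub>\<infinity>x\<in>A. \<bar>g x\<bar>)"
proof -
  have s: "(\<lambda>x. \<bar>f x\<bar> + \<bar>g x\<bar>) summable_on A" by (rule summable_on_add[OF assms])
  show 1: "(\<lambda>x. \<bar>f x + g x\<bar>) summable_on A"
    by (rule summable_on_comparison_test[OF s]) auto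
  show "(\<Sum>\<^sub>\<infinity>x\<in>A. \<bar>f x + g x\<bar>) \<le> (\<Sum>\<^sub>\<infinity>x\<in>A. \<bar>f x\<bar>) + (\<Sum>\<^sub>\<infinity>x\<in>A. \<bar>g x\<bar>)"
    unfolding infsum_add[OF assms, symmetric] by (rule infsum_mono[OF 1 s]) auto
qed

lemma abs_summable_mult_bounded:
  fixes f c :: "'x \<Rightarrow> real"
  assumes "(\<lambda>x. \<bar>f x\<bar>) summable_on A" "\<And>x. x \<in> A \<Longrightarrow> \<bar>c x\<bar> \<le> B"
  shows "(\<lambda>x. \<bar>f x * c x\<bar>) summable_on A"
proof (rule summable_on_comparison_test)
  show "(\<lambda>x. \<bar>f x\<bar> * B) summable_on A" using assms(1) by (rule summable_on_cmult_left)
qed (use assms(2) in \<open>auto simp: abs_mult intro: mult_left_mono\<close>)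

lemma has_sum_sum_finite:
  fixes f :: "'i \<Rightarrow> 'x \<Rightarrow> real"
  assumes "finite F" "\<And>i. i \<in> F \<Longrightarrow> f i summable_on A"
  shows "((\<lambda>x. \<Sum>i\<in>F. f i x) has_sum (\<Sum>i\<in>F. infsum (f i) A)) A"
  using assms by (induction rule: finite_induct) (auto intro!: has_sum_add has_sum_0)

text \<open>A kernel whose rows are bounded in \<open>\<ell>\<^sup>1\<close> defines a bounded operator on \<open>\<ell>\<^sup>1\<close>. The norm is a
  supremum of finite partial sums over \<open>I\<close>, and these can be exchanged with the sum over \<open>A\<close>.\<close>

lemma l1_kernel_bound:
  fixes f :: "'x \<Rightarrow> real" and m :: "'x \<Rightarrow> 'i \<Rightarrow> real"
  assumes f: "(\<lambda>x. \<bar>f x\<bar>) summable_on A"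
    and m: "\<And>x F. x \<in> A \<Longrightarrow> finite F \<Longrightarrow> F \<subseteq> I \<Longrightarrow> (\<Sum>i\<in>F. \<bar>m x i\<bar>) \<le> C"
  shows "(\<lambda>i. \<bar>\<Sum>\<^sub>\<infinity>x\<in>A. f x * m x i\<bar>) summable_on I"
    and "(\<Sum>\<^sub>\<infinity>i\<in>I. \<bar>\<Sum>\<^sub>\<infinity>x\<in>A. f x * m x i\<bar>) \<le> C * (\<Sum>\<^sub>\<infinity>x\<in>A. \<bar>f x\<bar>)"
proof -
  have sum: "(\<lambda>x. \<bar>f x * m x i\<bar>) summable_on A" if "i \<in> I" for i
    using abs_summable_mult_bounded[OF f, of "\<lambda>x. m x i" C] m[of _ "{i}"] that by auto
  have fin: "(\<Sum>i\<in>F. \<bar>\<Sum>\<^sub>\<infinity>x\<in>A. f x * m x i\<bar>) \<le> C * (\<Sum>\<^sub>\<infinity>x\<in>A. \<bar>f x\<bar>)"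
    if F: "finite F" "F \<subseteq> I" for F
  proof -
    have "(\<Sum>i\<in>F. \<bar>\<Sum>\<^sub>\<infinity>x\<in>A. f x * m x i\<bar>) \<le> (\<Sum>i\<in>F. \<Sum>\<^sub>\<infinity>x\<in>A. \<bar>f x * m x i\<bar>)"
      using norm_infsum_bound[of "\<lambda>x. f x * m x _" A] sum F
      by (intro sum_mono) (auto simp: subset_iff)
    also have "\<dots> = (\<Sum>\<^sub>\<infinity>x\<in>A. \<Sum>i\<in>F. \<bar>f x * m x i\<bar>)"
      using sum F by (intro infsumI[symmetric] has_sum_sum_finite) auto
    also have "\<dots> \<le> (\<Sum>\<^sub>\<infinity>x\<in>A. C * \<bar>f x\<bar>)"
    proof (rule infsum_mono)
      show "(\<lambda>x. \<Sum>i\<in>F. \<bar>f x * m x i\<bar>) summable_on A"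
        using sum F by (intro has_sum_imp_summable[OF has_sum_sum_finite]) auto
      show "(\<lambda>x. C * \<bar>f x\<bar>) summable_on A" using f by (rule summable_on_cmult_right)
      show "(\<Sum>i\<in>F. \<bar>f x * m x i\<bar>) \<le> C * \<bar>f x\<bar>" if "x \<in> A" for x
        using mult_right_mono[OF m[OF that F], of "\<bar>f x\<bar>"]
        by (simp add: abs_mult sum_distrib_left mult.commute)
    qed
    finally show ?thesis by (simp add: infsum_cmult_right')
  qed
  show "(\<lambda>i. \<bar>\<Sum>\<^sub>\<infinity>x\<in>A. f x * m x i\<bar>) summable_on I"
    using fin by (intro nonneg_bdd_above_summable_on) (auto intro!: bdd_aboveI)
  thus "(\<Sum>\<^sub>\<infinity>i\<in>I. \<bar>\<Sum>\<^sub>\<infinity>x\<in>A. f x * m x i\<bar>) \<le> C * (\<Sum>\<^sub>\<infinity>x\<in>A. \<bar>f x\<bar>)"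
    using fin by (intro infsum_le_finite_sums) auto
qed

section \<open>Translations are bounded for an almost additive flow\<close>

text \<open>The flow \<open>q a x\<close> from \<open>x\<close> to \<open>a\<close> is additive along \<open>x\<close>, \<open>b\<close>, \<open>a\<close> up to a bounded error; this is the
  mixed difference bound for the pairs \<open>a, b\<close> and \<open>x, b\<close>.\<close>

locale almost_additive_flow = group G for G (structure) +
  fixes q :: "'a \<Rightarrow> 'a \<Rightarrow> 'a \<times> 'a \<Rightarrow> real" and C :: real
  assumes countable_carrier: "countable (carrier G)"
    and q_bound: "a \<in> carrier G \<Longrightarrow> x \<in> carrier G \<Longrightarrow> i \<in> carrier G \<times> carrier G \<Longrightarrow> \<bar>q a x i\<bar> \<le> 1"
    and q_refl: "a \<in> carrier G \<Longrightarrow> q a a i = 0"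
    and q_translate: "g \<in> carrier G \<Longrightarrow> a \<in> carrier G \<Longrightarrow> x \<in> carrier G \<Longrightarrow> z \<in> carrier G \<Longrightarrow>
        w \<in> carrier G \<Longrightarrow> q (g \<otimes> a) (g \<otimes> x) (g \<otimes> z, g \<otimes> w) = q a x (z, w)"
    and q_support: "a \<in> carrier G \<Longrightarrow> x \<in> carrier G \<Longrightarrow>
        finite {i \<in> carrier G \<times> carrier G. q a x i \<noteq> 0}"
    and q_additive: "a \<in> carrier G \<Longrightarrow> b \<in> carrier G \<Longrightarrow> x \<in> carrier G \<Longrightarrow> finite F \<Longrightarrow>
        F \<subseteq> carrier G \<times> carrier G \<Longrightarrow> (\<Sum>i\<in>F. \<bar>q a x i - q a b i - q b x i\<bar>) \<le> C"
    and q_proper: "finite {x \<in> carrier G. \<forall>F. finite F \<longrightarrow> F \<subseteq> carrier G \<times> carrier G \<longrightarrow>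
        (\<Sum>i\<in>F. \<bar>q \<one> x i\<bar>) \<le> R}"
begin

abbreviation "\<Gamma> \<equiv> carrier G"

definition potential :: "('a \<Rightarrow> real) \<Rightarrow> 'a \<times> 'a \<Rightarrow> real" where
  "potential f i = (\<Sum>\<^sub>\<infinity>x\<in>\<Gamma>. f x * q \<one> x i)"

text \<open>All \<open>\<ell>\<^sup>1\<close> functions of sum zero with \<open>\<ell>\<^sup>1\<close> potential are admitted, rather than the completion of
  those with finite support. Pointwise the potential of an \<open>\<ell>\<^sup>1\<close> function converges because \<open>q\<close> is
  bounded, and so the space is cut out by continuous linear conditions and is complete.\<close>

definition finite_energy :: "('a \<Rightarrow> real) set" where
  "finite_energy = {f. (\<forall>x. x \<notin> \<Gamma> \<longrightarrow> f x = 0) \<and> (\<lambda>x. \<bar>f x\<bar>) summable_on \<Gamma> \<and> infsum f \<Gamma> = 0 \<and>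
           (\<lambda>i. \<bar>potential f i\<bar>) summable_on \<Gamma> \<times> \<Gamma>}"

definition energy_norm :: "('a \<Rightarrow> real) \<Rightarrow> real" where
  "energy_norm f = (\<Sum>\<^sub>\<infinity>x\<in>\<Gamma>. \<bar>f x\<bar>) + (\<Sum>\<^sub>\<infinity>i\<in>\<Gamma> \<times> \<Gamma>. \<bar>potential f i\<bar>)"

lemma finite_energyD:
  assumes "f \<in> finite_energy"
  shows "x \<notin> \<Gamma> \<Longrightarrow> f x = 0" "(\<lambda>x. \<bar>f x\<bar>) summable_on \<Gamma>" "infsum f \<Gamma> = 0"
    "(\<lambda>i. \<bar>potential f i\<bar>) summable_on \<Gamma> \<times> \<Gamma>"
  using assms by (auto simp: finite_energy_def)

lemma summable_mult_q:
  assumes "(\<lambda>x. \<bar>f x\<bar>) summable_on \<Gamma>" "a \<in> \<Gamma>" "i \<in> \<Gamma> \<times> \<Gamma>"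
  shows "(\<lambda>x. f x * q a x i) summable_on \<Gamma>"
proof (rule abs_summable_imp_summable)
  show "(\<lambda>x. \<bar>f x * q a x i\<bar>) summable_on \<Gamma>"
    by (rule abs_summable_mult_bounded[OF assms(1)]) (rule q_bound[OF assms(2) _ assms(3)])
qed

lemma potential_add:
  assumes "(\<lambda>x. \<bar>f x\<bar>) summable_on \<Gamma>" "(\<lambda>x. \<bar>g x\<bar>) summable_on \<Gamma>" "i \<in> \<Gamma> \<times> \<Gamma>"
  shows "potential (\<lambda>x. f x + g x) i = potential f i + potential g i"
  unfolding potential_def distrib_right by (intro infsum_add summable_mult_q assms one_closed)

lemma potential_scale: "potential (\<lambda>x. c * f x) i = c * potential f i"
  unfolding potential_def mult.assoc by (rule infsum_cmult_right')

lemma finite_energy_add: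
  assumes "f \<in> finite_energy" "g \<in> finite_energy"
  shows "(\<lambda>x. f x + g x) \<in> finite_energy"
proof -
  note f = finite_energyD[OF assms(1)] and g = finite_energyD[OF assms(2)]
  have "(\<lambda>i. \<bar>potential f i + potential g i\<bar>) summable_on \<Gamma> \<times> \<Gamma>"
    by (rule abs_summable_add(1)[OF f(4) g(4)])
  also have "?this \<longleftrightarrow> (\<lambda>i. \<bar>potential (\<lambda>x. f x + g x) i\<bar>) summable_on \<Gamma> \<times> \<Gamma>"
    using potential_add[OF f(2) g(2)] by (intro summable_on_cong) auto
  finally have "(\<lambda>i. \<bar>potential (\<lambda>x. f x + g x) i\<bar>) summable_on \<Gamma> \<times> \<Gamma>" .
  moreover have "infsum (\<lambda>x. f x + g x) \<Gamma> = 0"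
    using f g by (subst infsum_add) (auto intro: abs_summable_imp_summable)
  ultimately show ?thesis
    using f g abs_summable_add(1)[OF f(2) g(2)] by (auto simp: finite_energy_def)
qed

lemma finite_energy_scale:
  assumes "f \<in> finite_energy"
  shows "(\<lambda>x. c * f x) \<in> finite_energy"
proof -
  note f = finite_energyD[OF assms]
  show ?thesis
    using f summable_on_cmult_right[OF f(2), of "\<bar>c\<bar>"] summable_on_cmult_right[OF f(4), of "\<bar>c\<bar>"]
    by (auto simp: finite_energy_def potential_scale abs_mult infsum_cmult_right')
qed

definition translate :: "'a \<Rightarrow> ('a \<Rightarrow> real) \<Rightarrow> 'a \<Rightarrow> real" where
  "translate s f x = (if x \<in> \<Gamma> then f (inv s \<otimes> x) else 0)"

lemma bij_translation: "s \<in> \<Gamma> \<Longrightarrow> bij_betw (\<lambda>x. s \<otimes> x) \<Gamma> \<Gamma>"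
  by (rule bij_betw_byWitness[where f' = "\<lambda>x. inv s \<otimes> x"]) (auto simp flip: m_assoc)

lemma bij_translation_pairs:
  "s \<in> \<Gamma> \<Longrightarrow> bij_betw (\<lambda>(z, w). (s \<otimes> z, s \<otimes> w)) (\<Gamma> \<times> \<Gamma>) (\<Gamma> \<times> \<Gamma>)"
  by (rule bij_betw_byWitness[where f' = "\<lambda>(z, w). (inv s \<otimes> z, inv s \<otimes> w)"])
     (auto simp flip: m_assoc)

lemma translate_shift: "s \<in> \<Gamma> \<Longrightarrow> x \<in> \<Gamma> \<Longrightarrow> translate s f (s \<otimes> x) = f x"
  by (simp add: translate_def flip: m_assoc)

lemma infsum_translate:
  "s \<in> \<Gamma> \<Longrightarrow> (\<Sum>\<^sub>\<infinity>x\<in>\<Gamma>. h (translate s f x) x) = (\<Sum>\<^sub>\<infinity>x\<in>\<Gamma>. h (f x) (s \<otimes> x))"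
  by (subst infsum_reindex_bij_betw[OF bij_translation, symmetric, of s])
     (auto simp: translate_shift intro: infsum_cong)

lemma summable_translate:
  "s \<in> \<Gamma> \<Longrightarrow> (\<lambda>x. \<bar>f x\<bar>) summable_on \<Gamma> \<Longrightarrow> (\<lambda>x. \<bar>translate s f x\<bar>) summable_on \<Gamma>"
  by (subst summable_on_reindex_bij_betw[OF bij_translation, symmetric, of s])
     (auto simp: translate_shift cong: summable_on_cong)

text \<open>By equivariance the potential of the translate, moved back by \<open>s\<close>, is the potential of \<open>f\<close> for the
  base point \<open>s\<^sup>-\<^sup>1\<close>. Since \<open>f\<close> has sum zero, the flow from \<open>e\<close> to \<open>s\<^sup>-\<^sup>1\<close> may be subtracted from each
  \<open>q (s\<^sup>-\<^sup>1) x\<close>, which leaves the bounded failure of additivity.\<close>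

lemma potential_translate:
  assumes f: "f \<in> finite_energy" and s: "s \<in> \<Gamma>" and zw: "z \<in> \<Gamma>" "w \<in> \<Gamma>"
  shows "potential (translate s f) (s \<otimes> z, s \<otimes> w) = potential f (z, w) +
    (\<Sum>\<^sub>\<infinity>x\<in>\<Gamma>. f x * (q (inv s) x (z, w) - q (inv s) \<one> (z, w) - q \<one> x (z, w)))"
proof -
  note fe = finite_energyD[OF f]
  define m where "m x = q (inv s) x (z, w) - q (inv s) \<one> (z, w) - q \<one> x (z, w)" for x
  have inv_q: "q \<one> (s \<otimes> x) (s \<otimes> z, s \<otimes> w) = q (inv s) x (z, w)" if "x \<in> \<Gamma>" for x
    using q_translate[of s "inv s" x z w] s zw that by simp
  have sum_q: "(\<lambda>x. f x * q a x (z, w)) summable_on \<Gamma>" if "a \<in> \<Gamma>" for a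
    by (rule summable_mult_q[OF fe(2) that]) (use zw in simp)
  have sum_c: "(\<lambda>x. f x * q (inv s) \<one> (z, w)) summable_on \<Gamma>"
    by (rule summable_on_cmult_left[OF abs_summable_imp_summable[OF fe(2)]])
  have sum_m: "(\<lambda>x. f x * m x) summable_on \<Gamma>"
  proof (rule abs_summable_imp_summable[OF abs_summable_mult_bounded[OF fe(2)]])
    show "\<bar>m x\<bar> \<le> C" if "x \<in> \<Gamma>" for x
      using q_additive[of "inv s" \<one> x "{(z, w)}"] s zw that by (simp add: m_def)
  qed
  have "potential (translate s f) (s \<otimes> z, s \<otimes> w) = (\<Sum>\<^sub>\<infinity>x\<in>\<Gamma>. f x * q (inv s) x (z, w))"
    unfolding potential_def
    using infsum_translate[OF s, of "\<lambda>y x. y * q \<one> x (s \<otimes> z, s \<otimes> w)" f] inv_q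
    by (simp cong: infsum_cong)
  also have "\<dots> = (\<Sum>\<^sub>\<infinity>x\<in>\<Gamma>. (f x * q \<one> x (z, w) + f x * m x) + f x * q (inv s) \<one> (z, w))"
    by (simp add: m_def algebra_simps)
  \<comment> \<open>the last sum is zero because \<open>f\<close> has sum zero\<close>
  also have "\<dots> = (\<Sum>\<^sub>\<infinity>x\<in>\<Gamma>. f x * q \<one> x (z, w) + f x * m x)
      + (\<Sum>\<^sub>\<infinity>x\<in>\<Gamma>. f x * q (inv s) \<one> (z, w))"
    by (rule infsum_add[OF summable_on_add[OF sum_q[OF one_closed] sum_m] sum_c])
  also have "\<dots> = potential f (z, w) + (\<Sum>\<^sub>\<infinity>x\<in>\<Gamma>. f x * m x)"
    unfolding potential_def infsum_add[OF sum_q[OF one_closed] sum_m]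
    using fe(3) by (simp add: infsum_cmult_left')
  finally show ?thesis by (simp add: m_def)
qed

lemma finite_energy_translate:
  assumes f: "f \<in> finite_energy" and s: "s \<in> \<Gamma>"
  shows "translate s f \<in> finite_energy" and "energy_norm (translate s f) \<le> (1 + C) * energy_norm f"
proof -
  note fe = finite_energyD[OF f]
  define e where "e i = (\<Sum>\<^sub>\<infinity>x\<in>\<Gamma>. f x * (q (inv s) x i - q (inv s) \<one> i - q \<one> x i))" for i
  have e: "(\<lambda>i. \<bar>e i\<bar>) summable_on \<Gamma> \<times> \<Gamma>"
    "(\<Sum>\<^sub>\<infinity>i\<in>\<Gamma> \<times> \<Gamma>. \<bar>e i\<bar>) \<le> C * (\<Sum>\<^sub>\<infinity>x\<in>\<Gamma>. \<bar>f x\<bar>)"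
    unfolding e_def using s
    by (intro l1_kernel_bound[OF fe(2), where C = C] q_additive; simp)+
  define sh where "sh = (\<lambda>(z, w). (s \<otimes> z, s \<otimes> w))"
  have bij: "bij_betw sh (\<Gamma> \<times> \<Gamma>) (\<Gamma> \<times> \<Gamma>)"
    unfolding sh_def using s by (rule bij_translation_pairs)
  have pot: "potential (translate s f) (sh i) = potential f i + e i" if "i \<in> \<Gamma> \<times> \<Gamma>" for i
    using potential_translate[OF f s] that by (auto simp: sh_def e_def)
  note pe = abs_summable_add[OF fe(4) e(1)]
  have "(\<lambda>i. \<bar>potential (translate s f) (sh i)\<bar>) summable_on \<Gamma> \<times> \<Gamma>"
    using pe(1) pot by (simp cong: summable_on_cong)
  hence "(\<lambda>i. \<bar>potential (translate s f) i\<bar>) summable_on \<Gamma> \<times> \<Gamma>"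
    by (subst (asm) summable_on_reindex_bij_betw[OF bij])
  moreover have "infsum (translate s f) \<Gamma> = 0"
    using infsum_translate[OF s, of "\<lambda>y x. y" f] fe(3) by simp
  ultimately show "translate s f \<in> finite_energy"
    using summable_translate[OF s fe(2)] by (auto simp: finite_energy_def translate_def)
  have "(\<Sum>\<^sub>\<infinity>i\<in>\<Gamma> \<times> \<Gamma>. \<bar>potential (translate s f) i\<bar>)
      = (\<Sum>\<^sub>\<infinity>i\<in>\<Gamma> \<times> \<Gamma>. \<bar>potential (translate s f) (sh i)\<bar>)"
    by (rule infsum_reindex_bij_betw[OF bij, symmetric])
  also have "\<dots> = (\<Sum>\<^sub>\<infinity>i\<in>\<Gamma> \<times> \<Gamma>. \<bar>potential f i + e i\<bar>)"
    using pot by (simp cong: infsum_cong)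
  also have "\<dots> \<le> (\<Sum>\<^sub>\<infinity>i\<in>\<Gamma> \<times> \<Gamma>. \<bar>potential f i\<bar>) + C * (\<Sum>\<^sub>\<infinity>x\<in>\<Gamma>. \<bar>f x\<bar>)"
    using pe(2) e(2) by linarith
  finally have "energy_norm (translate s f) \<le> energy_norm f + C * (\<Sum>\<^sub>\<infinity>x\<in>\<Gamma>. \<bar>f x\<bar>)"
    using infsum_translate[OF s, of "\<lambda>y x. \<bar>y\<bar>" f] by (simp add: energy_norm_def)
  also have "\<dots> \<le> energy_norm f + C * energy_norm f"
    using q_additive[of "\<one>" "\<one>" "\<one>" "{}"] by (intro add_left_mono mult_left_mono) (auto simp: energy_norm_def intro: infsum_nonneg)
  finally show "energy_norm (translate s f) \<le> (1 + C) * energy_norm f" by (simp add: algebra_simps)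
qed

definition cocycle :: "'a \<Rightarrow> 'a \<Rightarrow> real" where
  "cocycle s x = of_bool (x = s) - of_bool (x = \<one>)"

lemma infsum_cocycle:
  assumes "s \<in> \<Gamma>"
  shows "(\<Sum>\<^sub>\<infinity>x\<in>\<Gamma>. cocycle s x * h x) = h s - h \<one>"
proof -
  have "(\<Sum>\<^sub>\<infinity>x\<in>\<Gamma>. cocycle s x * h x) = (\<Sum>\<^sub>\<infinity>x\<in>{s, \<one>}. cocycle s x * h x)"
    using assms by (intro infsum_cong_neutral) (auto simp: cocycle_def)
  thus ?thesis by (cases "s = \<one>") (auto simp: cocycle_def)
qed

lemma potential_cocycle: "s \<in> \<Gamma> \<Longrightarrow> potential (cocycle s) i = q \<one> s i"
  unfolding potential_def by (simp add: infsum_cocycle q_refl)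

lemma finite_energy_cocycle:
  assumes "s \<in> \<Gamma>"
  shows "cocycle s \<in> finite_energy"
proof -
  have "(\<lambda>x. \<bar>cocycle s x\<bar>) summable_on {s, \<one>}" by simp
  also have "?this \<longleftrightarrow> (\<lambda>x. \<bar>cocycle s x\<bar>) summable_on \<Gamma>"
    using assms by (intro summable_on_cong_neutral) (auto simp: cocycle_def)
  finally have 1: "(\<lambda>x. \<bar>cocycle s x\<bar>) summable_on \<Gamma>" .
  have "(\<lambda>i. \<bar>q \<one> s i\<bar>) summable_on {i \<in> \<Gamma> \<times> \<Gamma>. q \<one> s i \<noteq> 0}"
    using q_support[of \<one> s] assms by (intro summable_on_finite) auto
  also have "?this \<longleftrightarrow> (\<lambda>i. \<bar>q \<one> s i\<bar>) summable_on \<Gamma> \<times> \<Gamma>"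
    by (intro summable_on_cong_neutral) auto
  finally have 2: "(\<lambda>i. \<bar>potential (cocycle s) i\<bar>) summable_on \<Gamma> \<times> \<Gamma>"
    by (simp add: potential_cocycle[OF assms])
  show ?thesis
    using 1 2 infsum_cocycle[OF assms, of "\<lambda>_. 1"] assms
    by (auto simp: finite_energy_def) (auto simp: cocycle_def)
qed

lemma cocycle_mult:
  "s \<in> \<Gamma> \<Longrightarrow> t \<in> \<Gamma> \<Longrightarrow> cocycle (s \<otimes> t) x = translate s (cocycle t) x + cocycle s x"
proof -
  assume st: "s \<in> \<Gamma>" "t \<in> \<Gamma>"
  have "inv s \<otimes> x = t \<longleftrightarrow> x = s \<otimes> t" "inv s \<otimes> x = \<one> \<longleftrightarrow> x = s" if "x \<in> \<Gamma>"
    using st that by (metis inv_solve_left inv_closed inv_inv, metis inv_solve_left r_one one_closed)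
  thus ?thesis using st by (auto simp: cocycle_def translate_def)
qed

text \<open>The potential of \<open>\<delta>\<^sub>s - \<delta>\<^sub>e\<close> is the flow from \<open>s\<close> to \<open>e\<close>, whose norm is proper.\<close>

lemma cocycle_proper: "finite {s \<in> \<Gamma>. energy_norm (cocycle s) \<le> R}"
proof (rule finite_subset[OF _ q_proper[of R]])
  show "{s \<in> \<Gamma>. energy_norm (cocycle s) \<le> R} \<subseteq> {x \<in> \<Gamma>. \<forall>F. finite F \<longrightarrow> F \<subseteq> \<Gamma> \<times> \<Gamma> \<longrightarrow>
        (\<Sum>i\<in>F. \<bar>q \<one> x i\<bar>) \<le> R}"
  proof clarify
    fix s F assume s: "s \<in> \<Gamma>" "energy_norm (cocycle s) \<le> R" and F: "finite F" "F \<subseteq> \<Gamma> \<times> \<Gamma>"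
    have "(\<Sum>i\<in>F. \<bar>q \<one> s i\<bar>) \<le> (\<Sum>\<^sub>\<infinity>i\<in>\<Gamma> \<times> \<Gamma>. \<bar>potential (cocycle s) i\<bar>)"
      using finite_sum_le_infsum[OF finite_energyD(4)[OF finite_energy_cocycle[OF s(1)]] F]
      by (simp add: potential_cocycle[OF s(1)])
    also have "\<dots> \<le> energy_norm (cocycle s)" by (simp add: energy_norm_def infsum_nonneg)
    finally show "(\<Sum>i\<in>F. \<bar>q \<one> s i\<bar>) \<le> R" using s(2) by simp
  qed
qed

end

section \<open>The action on a closed subspace\<close>

text \<open>This places \<open>\<ell>\<^sup>1(\<Gamma>) \<oplus> \<ell>\<^sup>1(\<Gamma> \<times> \<Gamma>)\<close> inside \<open>\<ell>\<^sup>1\<close> of the real line with counting measure.\<close>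

lemma countable_disjoint_real_codes:
  assumes "countable A" "countable B"
  obtains p :: "'x \<Rightarrow> real" and r :: "'y \<Rightarrow> real"
  where "inj_on p A" "inj_on r B" "p ` A \<inter> r ` B = {}"
proof -
  define code where "code y = real (to_nat_on (A <+> B) y)" for y
  have "inj_on (to_nat_on (A <+> B)) (A <+> B)"
    using assms by (intro inj_on_to_nat_on countable_Plus)
  hence inj: "inj_on code (A <+> B)"
    by (simp add: code_def inj_on_def)
  show ?thesis
  proof (rule that[of "\<lambda>x. code (Inl x)" "\<lambda>y. code (Inr y)"])
    show "(\<lambda>x. code (Inl x)) ` A \<inter> (\<lambda>y. code (Inr y)) ` B = {}"
      by (auto dest: inj_onD[OF inj])
  qed (auto intro!: inj_onI dest: inj_onD[OF inj])
qed

context almost_additive_flow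
begin

context
  fixes vertex :: "'a \<Rightarrow> real" and cell :: "'a \<times> 'a \<Rightarrow> real"
  assumes inj_vertex: "inj_on vertex \<Gamma>" and inj_cell: "inj_on cell (\<Gamma> \<times> \<Gamma>)"
    and disjoint: "vertex ` \<Gamma> \<inter> cell ` (\<Gamma> \<times> \<Gamma>) = {}"
begin

text \<open>The pair \<open>(f, \<Phi>(f))\<close>, written as one function on the real line.\<close>

definition vec :: "('a \<Rightarrow> real) \<Rightarrow> real \<Rightarrow> real" where
  "vec f r = (if r \<in> vertex ` \<Gamma> then f (inv_into \<Gamma> vertex r)
    else if r \<in> cell ` (\<Gamma> \<times> \<Gamma>) then potential f (inv_into (\<Gamma> \<times> \<Gamma>) cell r) else 0)"

lemma cell_not_vertex: "i \<in> \<Gamma> \<times> \<Gamma> \<Longrightarrow> cell i \<notin> vertex ` \<Gamma>"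
  using disjoint by blast

lemma vec_vertex: "x \<in> \<Gamma> \<Longrightarrow> vec f (vertex x) = f x"
  by (simp add: vec_def inj_vertex)

lemma vec_cell: "i \<in> \<Gamma> \<times> \<Gamma> \<Longrightarrow> vec f (cell i) = potential f i"
  using cell_not_vertex[of i] by (simp add: vec_def inj_cell)

lemma vec_outside: "r \<notin> vertex ` \<Gamma> \<union> cell ` (\<Gamma> \<times> \<Gamma>) \<Longrightarrow> vec f r = 0"
  by (simp add: vec_def)

lemma vec_eqI:
  assumes "\<And>x. x \<in> \<Gamma> \<Longrightarrow> F (vertex x) = f x" "\<And>i. i \<in> \<Gamma> \<times> \<Gamma> \<Longrightarrow> F (cell i) = potential f i"
    and "\<And>r. r \<notin> vertex ` \<Gamma> \<union> cell ` (\<Gamma> \<times> \<Gamma>) \<Longrightarrow> F r = 0"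
  shows "F = vec f"
proof
  fix r
  consider x where "x \<in> \<Gamma>" "r = vertex x" | i where "i \<in> \<Gamma> \<times> \<Gamma>" "r = cell i"
    | "r \<notin> vertex ` \<Gamma> \<union> cell ` (\<Gamma> \<times> \<Gamma>)" by blast
  thus "F r = vec f r"
    using assms by cases (simp_all add: vec_vertex vec_cell vec_outside)
qed

abbreviation "\<mu> \<equiv> count_space (UNIV :: real set)"

lemma vec_integrable:
  assumes "f \<in> finite_energy"
  shows "integrable \<mu> (vec f)" and "(\<integral>r. \<bar>vec f r\<bar> \<partial>\<mu>) = energy_norm f"
proof -
  note fe = finite_energyD[OF assms]
  have 1: "(\<lambda>x. \<bar>vec f (vertex x)\<bar>) summable_on \<Gamma>"
    using fe(2) by (simp add: vec_vertex cong: summable_on_cong)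
  have 2: "(\<lambda>i. \<bar>vec f (cell i)\<bar>) summable_on \<Gamma> \<times> \<Gamma>"
    using fe(4) by (simp add: vec_cell cong: summable_on_cong)
  have zero: "\<bar>vec f r\<bar> = 0" if "r \<notin> vertex ` \<Gamma> \<union> cell ` (\<Gamma> \<times> \<Gamma>)" for r
    using vec_outside[OF that] by simp
  note parts = infsum_two_parts[OF inj_vertex inj_cell disjoint zero 1 2]
  show "integrable \<mu> (vec f)"
    using parts(1) by (simp add: integrable_count_space_iff)
  have "(\<integral>r. \<bar>vec f r\<bar> \<partial>\<mu>) = (\<Sum>\<^sub>\<infinity>r. \<bar>vec f r\<bar>)"
    using parts(1) by (intro integral_count_space_infsum) simp
  also have "\<dots> = (\<Sum>\<^sub>\<infinity>x\<in>\<Gamma>. \<bar>vec f (vertex x)\<bar>) + (\<Sum>\<^sub>\<infinity>i\<in>\<Gamma> \<times> \<Gamma>. \<bar>vec f (cell i)\<bar>)"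
    by (rule parts(2))
  also have "\<dots> = energy_norm f"
    by (simp add: energy_norm_def vec_vertex vec_cell cong: infsum_cong)
  finally show "(\<integral>r. \<bar>vec f r\<bar> \<partial>\<mu>) = energy_norm f" .
qed

definition cls :: "('a \<Rightarrow> real) \<Rightarrow> (real \<Rightarrow> real) set" where
  "cls f = L1_class \<mu> (vec f)"

definition coord :: "(real \<Rightarrow> real) set \<Rightarrow> 'a \<Rightarrow> real" where
  "coord u x = (if x \<in> \<Gamma> then L1_rep u (vertex x) else 0)"

lemma coord_cls: "f \<in> finite_energy \<Longrightarrow> coord (cls f) = f"
  using finite_energyD(1)[of f]
  by (auto simp: coord_def cls_def L1_rep_count_space vec_integrable vec_vertex)

lemma cls_norm: "f \<in> finite_energy \<Longrightarrow> L1_norm \<mu> (cls f) = energy_norm f"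
  by (simp add: cls_def L1_norm_class vec_integrable)

lemma cls_add:
  assumes "f \<in> finite_energy" "g \<in> finite_energy"
  shows "L1_add \<mu> (cls f) (cls g) = cls (\<lambda>x. f x + g x)"
proof -
  have "(\<lambda>r. vec f r + vec g r) = vec (\<lambda>x. f x + g x)"
    using potential_add[OF finite_energyD(2)[OF assms(1)] finite_energyD(2)[OF assms(2)]]
    by (intro vec_eqI) (auto simp: vec_vertex vec_cell vec_outside)
  thus ?thesis using assms by (simp add: cls_def L1_add_class vec_integrable)
qed

lemma cls_scale:
  assumes "f \<in> finite_energy"
  shows "L1_scale \<mu> c (cls f) = cls (\<lambda>x. c * f x)"
proof -
  have "(\<lambda>r. c * vec f r) = vec (\<lambda>x. c * f x)"
    by (intro vec_eqI) (auto simp: vec_vertex vec_cell vec_outside potential_scale)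
  thus ?thesis using assms by (simp add: cls_def L1_scale_class vec_integrable)
qed

text \<open>Integrating \<open>F\<close> against \<open>relation i\<close> gives the difference between the value of \<open>F\<close> at the cell \<open>i\<close> and
  the potential at \<open>i\<close> of the restriction of \<open>F\<close> to the vertices.\<close>

definition relation :: "'a \<times> 'a \<Rightarrow> real \<Rightarrow> real" where
  "relation i r = (if r \<in> vertex ` \<Gamma> then - q \<one> (inv_into \<Gamma> vertex r) i
                   else if r = cell i then 1 else 0)"

definition relations :: "(real \<Rightarrow> real) set" where
  "relations = (\<lambda>r. indicator {r}) ` (- (vertex ` \<Gamma> \<union> cell ` (\<Gamma> \<times> \<Gamma>)))
      \<union> {indicator (vertex ` \<Gamma>)} \<union> relation ` (\<Gamma> \<times> \<Gamma>)"

lemma abs_relations_le: "c \<in> relations \<Longrightarrow> \<bar>c r\<bar> \<le> 1"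
  using q_bound
  by (auto simp: relations_def relation_def inj_vertex split: split_indicator)

lemma integral_relation:
  assumes F: "integrable \<mu> F"
  shows "(\<integral>r. indicator {r0} r * F r \<partial>\<mu>) = F r0"
    and "(\<integral>r. indicator (vertex ` \<Gamma>) r * F r \<partial>\<mu>) = (\<Sum>\<^sub>\<infinity>x\<in>\<Gamma>. F (vertex x))"
    and "i \<in> \<Gamma> \<times> \<Gamma> \<Longrightarrow>
      (\<integral>r. relation i r * F r \<partial>\<mu>) = F (cell i) - (\<Sum>\<^sub>\<infinity>x\<in>\<Gamma>. F (vertex x) * q \<one> x i)"
proof -
  have int: "(\<integral>r. c r * F r \<partial>\<mu>) = (\<Sum>\<^sub>\<infinity>r. c r * F r)" if "\<And>r. \<bar>c r\<bar> \<le> 1" for c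
    using integrable_weighted[OF F, of c] that
    by (intro integral_count_space_infsum) (simp flip: integrable_count_space_iff)
  have vs: "(\<lambda>x. F (vertex x)) summable_on \<Gamma>" "(\<lambda>x. \<bar>F (vertex x)\<bar>) summable_on \<Gamma>"
    using F abs_summable_imp_summable[of F UNIV]
    by (auto intro!: summable_on_part[OF inj_vertex] simp: integrable_count_space_iff)
  have "(\<Sum>\<^sub>\<infinity>r. indicator {r0} r * F r) = (\<Sum>\<^sub>\<infinity>r\<in>{r0}. F r)"
    by (intro infsum_cong_neutral) auto
  thus "(\<integral>r. indicator {r0} r * F r \<partial>\<mu>) = F r0"
    by (subst int) (auto split: split_indicator)
  have "(\<Sum>\<^sub>\<infinity>r. indicator (vertex ` \<Gamma>) r * F r) = infsum F (vertex ` \<Gamma>)"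
    by (intro infsum_cong_neutral) auto
  also have "\<dots> = (\<Sum>\<^sub>\<infinity>x\<in>\<Gamma>. F (vertex x))"
    using inj_vertex by (simp add: infsum_reindex o_def)
  finally show "(\<integral>r. indicator (vertex ` \<Gamma>) r * F r \<partial>\<mu>) = (\<Sum>\<^sub>\<infinity>x\<in>\<Gamma>. F (vertex x))"
    by (subst int) (auto split: split_indicator)
  assume i: "i \<in> \<Gamma> \<times> \<Gamma>"
  have at_vertex: "relation i (vertex x) * F (vertex x) = - (F (vertex x) * q \<one> x i)"
    if "x \<in> \<Gamma>" for x
    using that by (simp add: relation_def inj_vertex)
  have at_cell: "relation i (cell j) * F (cell j) = (if j = i then F (cell i) else 0)"
    if "j \<in> \<Gamma> \<times> \<Gamma>" for j
    using that i cell_not_vertex[of j] inj_onD[OF inj_cell, of j i] by (auto simp: relation_def)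
  have 1: "(\<lambda>x. relation i (vertex x) * F (vertex x)) summable_on \<Gamma>"
    using summable_mult_q[OF vs(2) one_closed i]
    by (simp add: at_vertex summable_on_uminus cong: summable_on_cong)
  have "(\<lambda>j. relation i (cell j) * F (cell j)) summable_on {i}" by simp
  also have "?this \<longleftrightarrow> (\<lambda>j. relation i (cell j) * F (cell j)) summable_on \<Gamma> \<times> \<Gamma>"
    using i by (intro summable_on_cong_neutral) (auto simp: at_cell)
  finally have 2: "(\<lambda>j. relation i (cell j) * F (cell j)) summable_on \<Gamma> \<times> \<Gamma>" .
  have zero: "relation i r * F r = 0" if "r \<notin> vertex ` \<Gamma> \<union> cell ` (\<Gamma> \<times> \<Gamma>)" for r
    using that i by (auto simp: relation_def)
  have "(\<integral>r. relation i r * F r \<partial>\<mu>) = (\<Sum>\<^sub>\<infinity>r. relation i r * F r)"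
    using i by (intro int abs_relations_le) (auto simp: relations_def)
  also have "\<dots> = (\<Sum>\<^sub>\<infinity>x\<in>\<Gamma>. relation i (vertex x) * F (vertex x))
      + (\<Sum>\<^sub>\<infinity>j\<in>\<Gamma> \<times> \<Gamma>. relation i (cell j) * F (cell j))"
    by (rule infsum_two_parts(2)[OF inj_vertex inj_cell disjoint zero 1 2])
  also have "(\<Sum>\<^sub>\<infinity>x\<in>\<Gamma>. relation i (vertex x) * F (vertex x))
      = - (\<Sum>\<^sub>\<infinity>x\<in>\<Gamma>. F (vertex x) * q \<one> x i)"
    by (simp add: at_vertex infsum_uminus cong: infsum_cong)
  also have "(\<Sum>\<^sub>\<infinity>j\<in>\<Gamma> \<times> \<Gamma>. relation i (cell j) * F (cell j))
      = (\<Sum>\<^sub>\<infinity>j\<in>{i}. relation i (cell j) * F (cell j))"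
    using i by (intro infsum_cong_neutral) (auto simp: at_cell)
  also have "\<dots> = F (cell i)" using i by (simp add: at_cell)
  finally show "(\<integral>r. relation i r * F r \<partial>\<mu>)
      = F (cell i) - (\<Sum>\<^sub>\<infinity>x\<in>\<Gamma>. F (vertex x) * q \<one> x i)" by simp
qed

text \<open>This is where closedness comes from: having the form \<open>(f, \<Phi>(f))\<close> with \<open>f\<close> of sum zero means being
  annihilated by bounded functions.\<close>

lemma cls_finite_energy_eq_annihilator:
  "cls ` finite_energy = {u \<in> L1_space \<mu>. \<forall>c\<in>relations. (\<integral>r. c r * L1_rep u r \<partial>\<mu>) = 0}"
proof (intro equalityI subsetI)
  fix u assume "u \<in> cls ` finite_energy"
  then obtain f where f: "f \<in> finite_energy" "u = cls f" by auto
  note int = vec_integrable(1)[OF f(1)]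
  have "(\<integral>r. c r * vec f r \<partial>\<mu>) = 0" if c: "c \<in> relations" for c
  proof -
    consider r where "r \<notin> vertex ` \<Gamma> \<union> cell ` (\<Gamma> \<times> \<Gamma>)" "c = indicator {r}"
      | "c = indicator (vertex ` \<Gamma>)" | i where "i \<in> \<Gamma> \<times> \<Gamma>" "c = relation i"
      using c unfolding relations_def by blast
    thus ?thesis
    proof cases
      case 1
      thus ?thesis using integral_relation(1)[OF int] vec_outside by simp
    next
      case 2
      thus ?thesis
        using integral_relation(2)[OF int] finite_energyD(3)[OF f(1)] by (simp add: vec_vertex cong: infsum_cong)
    next
      case 3
      thus ?thesis
        using integral_relation(3)[OF int 3(1)] vec_cell[OF 3(1)]
        by (simp add: vec_vertex potential_def cong: infsum_cong)
    qed
  qed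
  thus "u \<in> {u \<in> L1_space \<mu>. \<forall>c\<in>relations. (\<integral>r. c r * L1_rep u r \<partial>\<mu>) = 0}"
    using f int by (auto simp: cls_def L1_rep_count_space intro: L1_class_in_space)
next
  fix u assume u: "u \<in> {u \<in> L1_space \<mu>. \<forall>c\<in>relations. (\<integral>r. c r * L1_rep u r \<partial>\<mu>) = 0}"
  then obtain F where F: "integrable \<mu> F" "u = L1_class \<mu> F" by (auto elim: L1_space_cases)
  have ann: "(\<integral>r. c r * F r \<partial>\<mu>) = 0" if "c \<in> relations" for c
    using u that F by (simp add: L1_rep_count_space)
  define f where "f x = (if x \<in> \<Gamma> then F (vertex x) else 0)" for x
  have outside: "F r = 0" if "r \<notin> vertex ` \<Gamma> \<union> cell ` (\<Gamma> \<times> \<Gamma>)" for r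
    using ann[of "indicator {r}"] integral_relation(1)[OF F(1), of r] that
    by (auto simp: relations_def)
  have sum0: "(\<Sum>\<^sub>\<infinity>x\<in>\<Gamma>. F (vertex x)) = 0"
    using ann[of "indicator (vertex ` \<Gamma>)"] integral_relation(2)[OF F(1)] by (simp add: relations_def)
  have cells: "F (cell i) = potential f i" if "i \<in> \<Gamma> \<times> \<Gamma>" for i
    using ann[of "relation i"] integral_relation(3)[OF F(1) that] that
    by (simp add: relations_def potential_def f_def cong: infsum_cong)
  have F_vec: "F = vec f"
    using outside cells by (intro vec_eqI) (auto simp: f_def)
  have abs_F: "(\<lambda>r. \<bar>F r\<bar>) summable_on UNIV" using F(1) by (simp add: integrable_count_space_iff)
  have "(\<lambda>x. \<bar>f x\<bar>) summable_on \<Gamma>"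
    using summable_on_part[OF inj_vertex abs_F] by (simp add: f_def cong: summable_on_cong)
  moreover have "(\<lambda>i. \<bar>potential f i\<bar>) summable_on \<Gamma> \<times> \<Gamma>"
    using summable_on_part[OF inj_cell abs_F] by (simp add: cells cong: summable_on_cong)
  moreover have "infsum f \<Gamma> = 0" using sum0 by (simp add: f_def cong: infsum_cong)
  ultimately have "f \<in> finite_energy" by (auto simp: finite_energy_def f_def)
  thus "u \<in> cls ` finite_energy" using F(2) F_vec by (auto simp: cls_def)
qed

lemma translate_one: "f \<in> finite_energy \<Longrightarrow> translate \<one> f = f"
  using finite_energyD(1)[of f] by (auto simp: translate_def)

lemma translate_mult: "s \<in> \<Gamma> \<Longrightarrow> t \<in> \<Gamma> \<Longrightarrow> translate (s \<otimes> t) f = translate s (translate t f)"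
  by (auto simp: translate_def inv_mult_group m_assoc)

lemma L1_action:
  shows "L1_closed_subspace \<mu> (cls ` finite_energy)"
    and "affine_action G \<mu> (cls ` finite_energy) (\<lambda>s u. cls (translate s (coord u))) (\<lambda>s. cls (cocycle s))"
    and "uniformly_Lipschitz G \<mu> (cls ` finite_energy) (\<lambda>s u. cls (translate s (coord u)))"
    and "proper_cocycle G \<mu> (\<lambda>s. cls (cocycle s))"
proof -
  show closed: "L1_closed_subspace \<mu> (cls ` finite_energy)"
    unfolding cls_finite_energy_eq_annihilator
    by (rule L1_closed_subspace_annihilator) (auto intro: abs_relations_le)
  have norm: "L1_norm \<mu> (cls (translate s (coord u))) \<le> (1 + C) * L1_norm \<mu> u"
    if "s \<in> \<Gamma>" "u \<in> cls ` finite_energy" for s u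
    using that by (auto simp: coord_cls cls_norm finite_energy_translate)
  have translate_add: "translate s (\<lambda>x. f x + g x) = (\<lambda>x. translate s f x + translate s g x)"
    and translate_scale: "translate s (\<lambda>x. c * f x) = (\<lambda>x. c * translate s f x)" for s f g c
    by (auto simp: translate_def)
  have bounded: "bounded_operator \<mu> (cls ` finite_energy) (\<lambda>u. cls (translate s (coord u)))" if s: "s \<in> \<Gamma>" for s
    unfolding bounded_operator_def
  proof (intro conjI exI[of _ "1 + C"] ballI allI norm s)
    show "(\<lambda>u. cls (translate s (coord u))) \<in> cls ` finite_energy \<rightarrow> cls ` finite_energy"
      using s by (auto simp: coord_cls finite_energy_translate)
    show "cls (translate s (coord (L1_add \<mu> u v)))
        = L1_add \<mu> (cls (translate s (coord u))) (cls (translate s (coord v)))"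
      if "u \<in> cls ` finite_energy" "v \<in> cls ` finite_energy" for u v
      using that s by (auto simp: cls_add coord_cls finite_energy_add finite_energy_translate translate_add)
    show "cls (translate s (coord (L1_scale \<mu> c u))) = L1_scale \<mu> c (cls (translate s (coord u)))"
      if "u \<in> cls ` finite_energy" for c u
      using that s by (auto simp: cls_scale coord_cls finite_energy_scale finite_energy_translate translate_scale)
  qed
  show "affine_action G \<mu> (cls ` finite_energy) (\<lambda>s u. cls (translate s (coord u))) (\<lambda>s. cls (cocycle s))"
    unfolding affine_action_def
  proof (intro conjI ballI bounded)
    show "cls (cocycle (s \<otimes> t)) = L1_add \<mu> (cls (translate s (coord (cls (cocycle t))))) (cls (cocycle s))"
      if "s \<in> \<Gamma>" "t \<in> \<Gamma>" for s t
    proof -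
      have "cocycle (s \<otimes> t) = (\<lambda>x. translate s (cocycle t) x + cocycle s x)"
        using cocycle_mult[OF that] by blast
      thus ?thesis using that by (simp add: coord_cls cls_add finite_energy_cocycle finite_energy_translate)
    qed
  qed (auto simp: coord_cls translate_one translate_mult finite_energy_translate finite_energy_cocycle)
  show "uniformly_Lipschitz G \<mu> (cls ` finite_energy) (\<lambda>s u. cls (translate s (coord u)))"
    unfolding uniformly_Lipschitz_def
  proof (intro bdd_aboveI2 operator_norm_le norm)
    show "0 \<le> 1 + C" using q_additive[of \<one> \<one> \<one> "{}"] by simp
    show "L1_zero \<mu> \<in> cls ` finite_energy" using closed by (simp add: L1_closed_subspace_def)
  qed (use norm in auto)
  have "{s \<in> \<Gamma>. L1_norm \<mu> (cls (cocycle s)) \<le> R} = {s \<in> \<Gamma>. energy_norm (cocycle s) \<le> R}" for R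
    by (auto simp: cls_norm finite_energy_cocycle)
  thus "proper_cocycle G \<mu> (\<lambda>s. cls (cocycle s))"
    unfolding proper_cocycle_def using cocycle_proper by simp
qed

end

theorem proper_uniformly_Lipschitz_action:
  "\<exists>(M :: real measure) E \<pi> b. L1_closed_subspace M E \<and> affine_action G M E \<pi> b \<and>
      uniformly_Lipschitz G M E \<pi> \<and> proper_cocycle G M b"
proof -
  obtain vertex :: "'a \<Rightarrow> real" and cell :: "'a \<times> 'a \<Rightarrow> real"
    where "inj_on vertex \<Gamma>" "inj_on cell (\<Gamma> \<times> \<Gamma>)" "vertex ` \<Gamma> \<inter> cell ` (\<Gamma> \<times> \<Gamma>) = {}"
    using countable_disjoint_real_codes[OF countable_carrier countable_SIGMA[OF countable_carrier]]
      countable_carrier by metis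
  from L1_action[OF this] show ?thesis by blast
qed

end

section \<open>Hyperbolic groups act properly on a subspace of an integrable function space\<close>

theorem theorem1p2:
  fixes G :: "('a, 'b) monoid_scheme"
  assumes "hyperbolic_group G"
  shows "\<exists>(M :: real measure) E \<pi> b.
           L1_closed_subspace M E \<and> affine_action G M E \<pi> b \<and>
           uniformly_Lipschitz G M E \<pi> \<and> proper_cocycle G M b"
proof -
  from assms interpret group G by (simp add: hyperbolic_group_def)
  let ?\<Gamma> = "carrier G"
  obtain d \<delta> N where "hyperbolic_graph_metric ?\<Gamma> d \<delta> N"
    and d_translate: "\<And>g x y. g \<in> ?\<Gamma> \<Longrightarrow> x \<in> ?\<Gamma> \<Longrightarrow> y \<in> ?\<Gamma> \<Longrightarrow>
           d (g \<otimes>\<^bsub>G\<^esub> x) (g \<otimes>\<^bsub>G\<^esub> y) = d x y"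
    using hyperbolic_group_word_metric[OF assms] by blast
  then interpret hyperbolic_graph_metric ?\<Gamma> d \<delta> N by simp
  obtain C where C: "\<forall>s\<in>?\<Gamma>. \<forall>t\<in>?\<Gamma>. \<forall>x\<in>?\<Gamma>. \<forall>y\<in>?\<Gamma>. \<forall>F. finite F \<longrightarrow> F \<subseteq> ?\<Gamma> \<times> ?\<Gamma> \<longrightarrow>
      (\<Sum>i\<in>F. \<bar>flow s x i - flow s y i - flow t x i + flow t y i\<bar>) \<le> C"
    using mixed_difference_bounded by (elim exE)
  have "almost_additive_flow G flow C"
  proof
    have "countable (\<Union>r. {x \<in> ?\<Gamma>. d \<one>\<^bsub>G\<^esub> x \<le> r})"
      by (intro countable_UN countable_finite finite_ball one_closed countableI_type)
    also have "(\<Union>r. {x \<in> ?\<Gamma>. d \<one>\<^bsub>G\<^esub> x \<le> r}) = ?\<Gamma>" by auto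
    finally show "countable ?\<Gamma>" .
    show "flow (g \<otimes>\<^bsub>G\<^esub> a) (g \<otimes>\<^bsub>G\<^esub> x) (g \<otimes>\<^bsub>G\<^esub> z, g \<otimes>\<^bsub>G\<^esub> w) = flow a x (z, w)"
      if "g \<in> ?\<Gamma>" "a \<in> ?\<Gamma>" "x \<in> ?\<Gamma>" "z \<in> ?\<Gamma>" "w \<in> ?\<Gamma>" for g a x z w
    proof (rule flow_isometry[where f = "\<lambda>x. g \<otimes>\<^bsub>G\<^esub> x"])
      show "bij_betw (\<lambda>x. g \<otimes>\<^bsub>G\<^esub> x) ?\<Gamma> ?\<Gamma>"
        using that(1) by (intro bij_betw_byWitness[where f' = "\<lambda>x. inv\<^bsub>G\<^esub> g \<otimes>\<^bsub>G\<^esub> x"])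
          (auto simp flip: m_assoc)
    qed (use that d_translate in auto)
    show "(\<Sum>i\<in>F. \<bar>flow a x i - flow a b i - flow b x i\<bar>) \<le> C"
      if "a \<in> ?\<Gamma>" "b \<in> ?\<Gamma>" "x \<in> ?\<Gamma>" "finite F" "F \<subseteq> ?\<Gamma> \<times> ?\<Gamma>" for a b x F
    proof -
      have "(\<Sum>i\<in>F. \<bar>flow a x i - flow a b i - flow b x i + flow b b i\<bar>) \<le> C"
        by (intro C[rule_format] that)
      thus ?thesis by (simp add: flow_refl)
    qed
    show "finite {x \<in> ?\<Gamma>. \<forall>F. finite F \<longrightarrow> F \<subseteq> ?\<Gamma> \<times> ?\<Gamma> \<longrightarrow> (\<Sum>i\<in>F. \<bar>flow \<one>\<^bsub>G\<^esub> x i\<bar>) \<le> R}"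
      (is "finite ?B") for R
    proof (rule finite_subset)
      define r where "r = nat \<lceil>8 * R\<rceil> + anchor_radius"
      show "finite {x \<in> ?\<Gamma>. d \<one>\<^bsub>G\<^esub> x \<le> r}" by (rule finite_ball) simp
      show "?B \<subseteq> {x \<in> ?\<Gamma>. d \<one>\<^bsub>G\<^esub> x \<le> r}"
      proof
        fix x assume x: "x \<in> ?B"
        then obtain F where "F \<subseteq> ?\<Gamma> \<times> ?\<Gamma>" "finite F"
          "(real (d \<one>\<^bsub>G\<^esub> x) - real anchor_radius) / 8 \<le> (\<Sum>i\<in>F. \<bar>flow \<one>\<^bsub>G\<^esub> x i\<bar>)"
          using flow_sum_ge[OF one_closed, of x] by auto
        hence "(real (d \<one>\<^bsub>G\<^esub> x) - real anchor_radius) / 8 \<le> R" using x by fastforce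
        hence "real (d \<one>\<^bsub>G\<^esub> x) \<le> real (nat \<lceil>8 * R\<rceil>) + real anchor_radius"
          using real_nat_ceiling_ge[of "8 * R"] by simp
        hence "d \<one>\<^bsub>G\<^esub> x \<le> r" by (simp add: r_def flip: of_nat_add)
        thus "x \<in> {x \<in> ?\<Gamma>. d \<one>\<^bsub>G\<^esub> x \<le> r}" using x by simp
      qed
    qed
  qed (auto intro: abs_flow_le flow_refl finite_flow_support)
  thus ?thesis by (rule almost_additive_flow.proper_uniformly_Lipschitz_action)
qed

end
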